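(* Let $\mathbf{X}=(X_1,\ldots,X_N)^\intercal$ be a vector of $N\in\mathbb{N}$ input random variables fulfilling the assumptions listed in the context. Then $\{\Psi_{\mathbf{i},\mathbf{p},\boldsymbol{\Xi}}(\mathbf{x}):\mathbf{i}\in\mathcal{I}_{\mathbf{n}}\}$, the set of multivariate orthonormal B-splines for a chosen degree $\mathbf{p}$ and family of knot sequences $\boldsymbol{\Xi}$, consistent with the probability measure $f_{\mathbf{X}}(\mathbf{x})d\mathbf{x}$, is a basis of $\mathcal{S}_{\mathbf{p},\boldsymbol{\Xi}}$. That is, $$\mathcal{S}_{\mathbf{p},\boldsymbol{\Xi}}=\operatorname{span}\{\Psi_{\mathbf{i},\mathbf{p},\boldsymbol{\Xi}}(\mathbf{x})\}_{\mathbf{i}\in\mathcal{I}_{\mathbf{n}}}=\bigotimes_{k=1}^N\operatorname{span}\{\psi^k_{i_k,p_k,\boldsymbol{\xi}_k}(x_k)\}_{i_k=1,\ldots,n_k},\qquad|\mathcal{I}_{\mathbf{n}}|=\prod_{k=1}^Nn_k.$$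
   Context: Inputs. $\mathbb{N}=\{1,2,\ldots\}$, $\mathbb{N}_0=\mathbb{N}\cup\{0\}$. $(\Omega,\mathcal{F},\mathbb{P})$ is a probability space, $\mathbb{A}^N=\times_{k=1}^N[a_k,b_k]$ with finite reals $a_k<b_k$, $\mathcal{B}^N$ is the Borel $\sigma$-algebra on $\mathbb{A}^N$, and $\mathbf{X}=(X_1,\ldots,X_N)^\intercal:(\Omega,\mathcal{F})\to(\mathbb{A}^N,\mathcal{B}^N)$ is a random vector such that: (1) the $X_k$ are statistically independent (not necessarily identically distributed); (2) each $X_k$ takes values in $[a_k,b_k]$ (so all its moments are finite); (3) each $X_k$ has an absolutely continuous distribution function and a density $f_{X_k}$, continuous on $[a_k,b_k]$, with support $[a_k,b_k]$ (the closure of $\{f_{X_k}>0\}$). The joint density is $f_{\mathbf{X}}(\mathbf{x})=\prod_{k=1}^Nf_{X_k}(x_k)$, with support $\mathbb{A}^N$. Univariate B-splines. For each $k$, let $n_k>p_k\ge0$ be integers and let $\boldsymbol{\xi}_k=\{\xi_{k,1}\le\cdots\le\xi_{k,n_k+p_k+1}\}$ be a $(p_k+1)$-open knot sequence on $[a_k,b_k]$: its distinct values are $a_k=\zeta_{k,1}<\cdots<\zeta_{k,r_k}=b_k$, with multiplicities $m_{k,1}=m_{k,r_k}=p_k+1$ and $1\le m_{k,j}\le p_k+1$ for $2\le j\le r_k-1$. B-splines: $B^k_{i,0,\boldsymbol{\xi}_k}(x)=1$ if $\xi_{k,i}\le x<\xi_{k,i+1}$ and $0$ otherwise; for $q\ge1$,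 $B^k_{i,q,\boldsymbol{\xi}_k}(x)=\frac{x-\xi_{k,i}}{\xi_{k,i+q}-\xi_{k,i}}B^k_{i,q-1,\boldsymbol{\xi}_k}(x)+\frac{\xi_{k,i+q+1}-x}{\xi_{k,i+q+1}-\xi_{k,i+1}}B^k_{i+1,q-1,\boldsymbol{\xi}_k}(x)$, terms with zero denominator being zero; values at $x=b_k$ are taken as left limits. The degree-$p_k$ B-splines are $B^k_{i,p_k,\boldsymbol{\xi}_k}$, $1\le i\le n_k$. The spline space $\mathcal{S}_{k,p_k,\boldsymbol{\xi}_k}$ is the set of $g:[a_k,b_k]\to\mathbb{R}$ for which there are real polynomials $g_1,\ldots,g_{r_k-1}$ of degree at most $p_k$ with $g=g_j$ on $[\zeta_{k,j},\zeta_{k,j+1})$ (the last interval closed at $b_k$) and $g_{j-1}^{(l)}(\zeta_{k,j})=g_j^{(l)}(\zeta_{k,j})$ for $0\le l\le p_k-m_{k,j}$, $2\le j\le r_k-1$. It is known that $\mathcal{S}_{k,p_k,\boldsymbol{\xi}_k}=\operatorname{span}\{B^k_{i,p_k,\boldsymbol{\xi}_k}\}_{i=1}^{n_k}$ has dimension $n_k$. Orthonormal B-splines. $\mathbf{P}_k(x_k)=(1,B^k_{2,p_k,\boldsymbol{\xi}_k}(x_k),\ldots,B^k_{n_k,p_k,\boldsymbol{\xi}_k}(x_k))^\intercal$, $\mathbf{G}_k=\mathbb{E}[\mathbf{P}_k(X_k)\mathbf{P}_k^\intercal(X_k)]$ (symmetric positive-definite), $\mathbf{G}_k=\mathbf{Q}_k\mathbf{Q}_k^\intercal$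 is the Cholesky factorization ($\mathbf{Q}_k$ lower triangular with positive diagonal), and $\boldsymbol{\psi}_k(x_k)=(\psi^k_{1,p_k,\boldsymbol{\xi}_k}(x_k),\ldots,\psi^k_{n_k,p_k,\boldsymbol{\xi}_k}(x_k))^\intercal=\mathbf{Q}_k^{-1}\mathbf{P}_k(x_k)$. For $\mathbf{p}=(p_1,\ldots,p_N)\in\mathbb{N}_0^N$, $\boldsymbol{\Xi}=\{\boldsymbol{\xi}_1,\ldots,\boldsymbol{\xi}_N\}$, $\mathbf{n}=(n_1,\ldots,n_N)$ and $\mathcal{I}_{\mathbf{n}}=\{(i_1,\ldots,i_N):1\le i_k\le n_k,\ k=1,\ldots,N\}$, the multivariate orthonormal B-splines are $\Psi_{\mathbf{i},\mathbf{p},\boldsymbol{\Xi}}(\mathbf{x})=\prod_{k=1}^N\psi^k_{i_k,p_k,\boldsymbol{\xi}_k}(x_k)$. The tensor-product spline space is $\mathcal{S}_{\mathbf{p},\boldsymbol{\Xi}}=\bigotimes_{k=1}^N\mathcal{S}_{k,p_k,\boldsymbol{\xi}_k}$; here the tensor product of spaces $V_k$ of functions of $x_k$ is the span of the functions $\mathbf{x}\mapsto\prod_kg_k(x_k)$ with $g_k\in V_k$. *)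

theory Defs
  imports
    "HOL-Probability.Probability"
    "HOL-Computational_Algebra.Polynomial"
    "HOL-Library.Function_Algebras"
    "Jordan_Normal_Form.Gauss_Jordan_Elimination"
begin

text \<open>
  From here on \<open>x $ k\<close> is a coordinate of \<open>x :: real ^ 'n\<close>; entries of
  Jordan-Normal-Form vectors are written with \<open>vec_index\<close>.
\<close>
no_notation vec_index (infixl "$" 100)

text \<open>
  Functions on a domain \<open>D\<close> are encoded as total functions that are zero outside \<open>D\<close>, so that
  equality of total functions is equality on \<open>D\<close>. Here \<open>D\<close> is an interval
  \<open>[a, b]\<close> or a box \<^term>\<open>cbox a b\<close>; a product of univariate functions of this kind
  automatically vanishes outside the box.
\<close>

definition fscale :: "real \<Rightarrow> ('a \<Rightarrow> real) \<Rightarrow> 'a \<Rightarrow> real" where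
  "fscale c f = (\<lambda>x. c * f x)"

global_interpretation fun_space: vector_space "fscale :: real \<Rightarrow> ('a \<Rightarrow> real) \<Rightarrow> 'a \<Rightarrow> real"
  by unfold_locales (auto simp: fscale_def fun_eq_iff algebra_simps)

definition tensor_product :: "('n \<Rightarrow> (real \<Rightarrow> real) set) \<Rightarrow> (real ^ 'n::finite \<Rightarrow> real) set" where
  "tensor_product V = fun_space.span {\<lambda>x. \<Prod>k\<in>UNIV. g k (x $ k) | g. \<forall>k. g k \<in> V k}"

text \<open>Knots, breakpoints and B-splines are indexed from 1. A knot sequence is a function
  \<^typ>\<open>nat \<Rightarrow> real\<close> of which only the values at \<open>1, \<dots>, n + p + 1\<close> matter.\<close>

definition knot_set :: "nat \<Rightarrow> nat \<Rightarrow> (nat \<Rightarrow> real) \<Rightarrow> real set" where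
  "knot_set p n \<xi> = \<xi> ` {1..n + p + 1}"

definition num_breaks :: "nat \<Rightarrow> nat \<Rightarrow> (nat \<Rightarrow> real) \<Rightarrow> nat" where
  "num_breaks p n \<xi> = card (knot_set p n \<xi>)"

definition breakpoint :: "nat \<Rightarrow> nat \<Rightarrow> (nat \<Rightarrow> real) \<Rightarrow> nat \<Rightarrow> real" where
  "breakpoint p n \<xi> j = sorted_list_of_set (knot_set p n \<xi>) ! (j - 1)"

definition knot_mult :: "nat \<Rightarrow> nat \<Rightarrow> (nat \<Rightarrow> real) \<Rightarrow> nat \<Rightarrow> nat" where
  "knot_mult p n \<xi> j = card {i \<in> {1..n + p + 1}. \<xi> i = breakpoint p n \<xi> j}"

definition open_knots :: "real \<Rightarrow> real \<Rightarrow> nat \<Rightarrow> nat \<Rightarrow> (nat \<Rightarrow> real) \<Rightarrow> bool" where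
  "open_knots a b p n \<xi> \<longleftrightarrow>
     mono_on {1..n + p + 1} \<xi> \<and>
     breakpoint p n \<xi> 1 = a \<and> breakpoint p n \<xi> (num_breaks p n \<xi>) = b \<and>
     knot_mult p n \<xi> 1 = p + 1 \<and> knot_mult p n \<xi> (num_breaks p n \<xi>) = p + 1 \<and>
     (\<forall>j\<in>{2..num_breaks p n \<xi> - 1}. 1 \<le> knot_mult p n \<xi> j \<and> knot_mult p n \<xi> j \<le> p + 1)"

text \<open>The convention that terms with zero denominator vanish is \<open>x / 0 = 0\<close>.\<close>

fun bspline_rec :: "(nat \<Rightarrow> real) \<Rightarrow> nat \<Rightarrow> nat \<Rightarrow> real \<Rightarrow> real" where
  "bspline_rec \<xi> i 0 x = (if \<xi> i \<le> x \<and> x < \<xi> (i + 1) then 1 else 0)"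
| "bspline_rec \<xi> i (Suc q) x =
     (x - \<xi> i) / (\<xi> (i + Suc q) - \<xi> i) * bspline_rec \<xi> i q x +
     (\<xi> (i + Suc q + 1) - x) / (\<xi> (i + Suc q + 1) - \<xi> (i + 1)) * bspline_rec \<xi> (i + 1) q x"

definition bspline :: "real \<Rightarrow> (nat \<Rightarrow> real) \<Rightarrow> nat \<Rightarrow> nat \<Rightarrow> real \<Rightarrow> real" where
  "bspline b \<xi> i q x =
     (if x = b then Lim (at_left b) (bspline_rec \<xi> i q) else bspline_rec \<xi> i q x)"

text \<open>The smoothness condition \<open>l \<le> p - m\<close> is written \<open>l + m \<le> p\<close>, because it
  must be void for \<open>m = p + 1\<close>.\<close>

definition spline_space :: "real \<Rightarrow> real \<Rightarrow> nat \<Rightarrow> nat \<Rightarrow> (nat \<Rightarrow> real) \<Rightarrow> (real \<Rightarrow> real) set" where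
  "spline_space a b p n \<xi> =
     (let r = num_breaks p n \<xi>; \<zeta> = breakpoint p n \<xi>; m = knot_mult p n \<xi> in
      {g. (\<forall>x. x \<notin> {a..b} \<longrightarrow> g x = 0) \<and>
          (\<exists>h :: nat \<Rightarrow> real poly.
             (\<forall>j\<in>{1..r - 1}. degree (h j) \<le> p) \<and>
             (\<forall>j\<in>{1..r - 1}. \<forall>x\<in>{\<zeta> j..<\<zeta> (j + 1)}. g x = poly (h j) x) \<and>
             g b = poly (h (r - 1)) b \<and>
             (\<forall>j\<in>{2..r - 1}. \<forall>l. l + m j \<le> p \<longrightarrow>
                poly ((pderiv ^^ l) (h (j - 1))) (\<zeta> j) = poly ((pderiv ^^ l) (h j)) (\<zeta> j)))})"

text \<open>Matrices and vectors of the library are indexed from 0.\<close>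

definition aux_vec :: "real \<Rightarrow> nat \<Rightarrow> nat \<Rightarrow> (nat \<Rightarrow> real) \<Rightarrow> real \<Rightarrow> real Matrix.vec" where
  "aux_vec b p n \<xi> x = Matrix.vec n (\<lambda>i. if i = 0 then 1 else bspline b \<xi> (i + 1) p x)"

definition moment_mat ::
  "'w measure \<Rightarrow> ('w \<Rightarrow> real) \<Rightarrow> real \<Rightarrow> nat \<Rightarrow> nat \<Rightarrow> (nat \<Rightarrow> real) \<Rightarrow> real Matrix.mat" where
  "moment_mat M Y b p n \<xi> = Matrix.mat n n (\<lambda>(i, j).
     LINT \<omega>|M. vec_index (aux_vec b p n \<xi> (Y \<omega>)) i * vec_index (aux_vec b p n \<xi> (Y \<omega>)) j)"

definition is_cholesky_factor :: "real Matrix.mat \<Rightarrow> real Matrix.mat \<Rightarrow> bool" where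
  "is_cholesky_factor G Q \<longleftrightarrow>
     Q \<in> carrier_mat (dim_row G) (dim_row G) \<and>
     upper_triangular (transpose_mat Q) \<and>
     (\<forall>i<dim_row G. Q $$ (i, i) > 0) \<and>
     G = Q * transpose_mat Q"

definition cholesky :: "real Matrix.mat \<Rightarrow> real Matrix.mat" where
  "cholesky G = (THE Q. is_cholesky_factor G Q)"

definition orth_bspline ::
  "'w measure \<Rightarrow> ('w \<Rightarrow> real) \<Rightarrow> real \<Rightarrow> real \<Rightarrow> nat \<Rightarrow> nat \<Rightarrow> (nat \<Rightarrow> real) \<Rightarrow> nat \<Rightarrow> real \<Rightarrow> real" where
  "orth_bspline M Y a b p n \<xi> i x =
     (if x \<in> {a..b}
      then vec_index (the (mat_inverse (cholesky (moment_mat M Y b p n \<xi>))) *\<^sub>v aux_vec b p n \<xi> x) (i - 1)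
      else 0)"

definition multi_orth_bspline ::
  "'w measure \<Rightarrow> ('w \<Rightarrow> real ^ 'n::finite) \<Rightarrow> real ^ 'n \<Rightarrow> real ^ 'n \<Rightarrow> ('n \<Rightarrow> nat) \<Rightarrow> ('n \<Rightarrow> nat) \<Rightarrow>
   ('n \<Rightarrow> nat \<Rightarrow> real) \<Rightarrow> ('n \<Rightarrow> nat) \<Rightarrow> real ^ 'n \<Rightarrow> real" where
  "multi_orth_bspline M X a b p n \<xi> i x =
     (\<Prod>k\<in>UNIV. orth_bspline M (\<lambda>\<omega>. X \<omega> $ k) (a $ k) (b $ k) (p k) (n k) (\<xi> k) (i k) (x $ k))"

definition multi_indices :: "('n \<Rightarrow> nat) \<Rightarrow> ('n \<Rightarrow> nat) set" where
  "multi_indices n = {i. \<forall>k. 1 \<le> i k \<and> i k \<le> n k}"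

end

theory Submission
  imports Defs "Jordan_Normal_Form.Determinant"
begin

text \<open>
  The proof has a univariate part, in which the functions \<open>\<psi>\<^sub>k\<close> are shown to be an orthonormal
  basis of the spline space on \<open>[a\<^sub>k, b\<^sub>k]\<close>, and a short multivariate part.

  The first step in one variable is that the B-splines generate the spline space. Marsden's identity
  (\<open>marsden\<close>) expands \<open>(y - x)^p\<close> in B-splines in \<open>x\<close> with the dual polynomials
  \<open>\<Prod>\<^sub>j (y - \<xi>\<^sub>i\<^sub>+\<^sub>j)\<close> as coefficients. Pairing it with a polynomial \<open>h\<close> in the
  bilinear form of de Boor and Fix recovers \<open>h(x)\<close> from the B-splines at \<open>x\<close>, with coefficients that
  are linear functionals of \<open>h\<close>. For the pieces of a spline the functional that belongs to a B-spline
  does not depend on the piece inside its support: at a breakpoint of multiplicity \<open>m\<close> the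
  dual polynomial has a zero of order \<open>m\<close>, and the pieces agree in the other derivatives
  (\<open>dual_functional_step\<close>). Hence each spline is one global combination of B-splines.

  Conversely, the \<open>n\<close> truncated powers at the knots are linearly independent splines. Since the
  \<open>n\<close> functions \<open>1, B\<^sub>2, \<dots>, B\<^sub>n\<close> generate all splines, they must be a basis
  (\<open>aux_spline_basis\<close>); in particular they are splines.

  A spline that vanishes almost surely at a random variable with a continuous density supported on
  all of \<open>[a, b]\<close> is zero, because its pieces are polynomials (\<open>spline_zero_if_AE_zero\<close>). So the
  moment matrix is positive definite, it has exactly one Cholesky factor, this factor is invertible,
  and its inverse turns the basis into an orthonormal one with the same span.

  In several variables, independence of the coordinates makes the products of the univariate
  orthonormal functions orthonormal (\<open>orthonormal_products\<close>), which gives their linear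
  independence, and multiplying out products of linear combinations shows that they span the tensor
  product of the univariate spans (\<open>tensor_product_span\<close>).
\<close>

(* smult denotes scalar multiplication of polynomials throughout *)
hide_const (open) module.smult

section \<open>Finite families of functions\<close>

lemma sum_fscale_apply:
  "(\<Sum>i\<in>I. fscale (c i) (t i)) x = (\<Sum>i\<in>I. c i * t i x)"
  by (induction I rule: infinite_finite_induct) (auto simp: fscale_def)

lemma span_family_iff:
  assumes "finite I"
  shows "g \<in> fun_space.span (t ` I) \<longleftrightarrow> (\<exists>c. g = (\<Sum>i\<in>I. fscale (c i) (t i)))"
proof
  let ?L = "{g. \<exists>c. g = (\<Sum>i\<in>I. fscale (c i) (t i))}"
  have "fun_space.subspace ?L"
  proof (unfold fun_space.subspace_def, safe)
    show "\<exists>c. 0 = (\<Sum>i\<in>I. fscale (c i) (t i))"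
      by (intro exI[of _ "\<lambda>_. 0"]) simp
    fix c d e
    show "\<exists>c'. (\<Sum>i\<in>I. fscale (c i) (t i)) + (\<Sum>i\<in>I. fscale (d i) (t i)) = (\<Sum>i\<in>I. fscale (c' i) (t i))"
      by (intro exI[of _ "\<lambda>i. c i + d i"]) (simp add: fun_space.scale_left_distrib sum.distrib)
    show "\<exists>c'. fscale e (\<Sum>i\<in>I. fscale (c i) (t i)) = (\<Sum>i\<in>I. fscale (c' i) (t i))"
      by (intro exI[of _ "\<lambda>i. e * c i"]) (simp add: fun_space.scale_sum_right)
  qed
  moreover have "t ` I \<subseteq> ?L"
  proof safe
    fix i assume "i \<in> I"
    have "fscale (if j = i then 1 else 0) (t j) = (if j = i then t j else 0)" for j
      by (simp add: fun_eq_iff fscale_def)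
    then show "\<exists>c. t i = (\<Sum>i\<in>I. fscale (c i) (t i))"
      using \<open>i \<in> I\<close> assms by (intro exI[of _ "\<lambda>j. if j = i then 1 else 0"]) simp
  qed
  ultimately have "fun_space.span (t ` I) \<subseteq> ?L"
    by (rule fun_space.span_minimal[rotated])
  then show "g \<in> fun_space.span (t ` I) \<Longrightarrow> \<exists>c. g = (\<Sum>i\<in>I. fscale (c i) (t i))" by blast
next
  show "\<exists>c. g = (\<Sum>i\<in>I. fscale (c i) (t i)) \<Longrightarrow> g \<in> fun_space.span (t ` I)"
    by (auto intro!: fun_space.span_sum fun_space.span_scale intro: fun_space.span_base)
qed

lemma independent_familyI:
  assumes "finite I"
    and zero: "\<And>c i. (\<And>x. (\<Sum>i\<in>I. c i * t i x) = 0) \<Longrightarrow> i \<in> I \<Longrightarrow> c i = 0"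
  shows "inj_on t I" "fun_space.independent (t ` I)"
proof -
  show inj: "inj_on t I"
  proof (rule inj_onI, rule ccontr)
    fix i j assume ij: "i \<in> I" "j \<in> I" "t i = t j" "i \<noteq> j"
    define c where "c = (\<lambda>k. (if k = i then 1 else 0) - (if k = j then 1 else (0::real)))"
    have "(\<Sum>k\<in>I. c k * t k x) = 0" for x
    proof -
      have "c k * t k x = (if k = i then t k x else 0) - (if k = j then t k x else 0)" for k
        by (simp add: c_def)
      then show ?thesis using ij \<open>finite I\<close> by (simp add: sum_subtractf)
    qed
    from zero[of c i, OF this] ij show False by (simp add: c_def)
  qed
  show "fun_space.independent (t ` I)"
  proof (rule fun_space.independent_if_scalars_zero)
    show "finite (t ` I)" using \<open>finite I\<close> by simp
    fix f v assume f: "(\<Sum>v\<in>t ` I. fscale (f v) v) = 0" and "v \<in> t ` I"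
    then obtain i where i: "i \<in> I" "v = t i" by blast
    have "(\<Sum>i\<in>I. f (t i) * t i x) = 0" for x
      using fun_cong[OF f, of x] inj
      by (simp add: sum.reindex sum_fscale_apply[of "\<lambda>i. f (t i)" t])
    from zero[of "\<lambda>i. f (t i)", OF this i(1)] i show "f v = 0" by simp
  qed
qed

lemma independent_familyD:
  assumes "finite I" "inj_on t I" "fun_space.independent (t ` I)"
    and "\<And>x. (\<Sum>i\<in>I. c i * t i x) = 0" "i \<in> I"
  shows "c i = 0"
proof -
  have "(\<Sum>v\<in>t ` I. fscale (c (inv_into I t v)) v) = (\<Sum>i\<in>I. fscale (c i) (t i))"
    using assms(2) by (simp add: sum.reindex)
  also have "\<dots> = 0"
    using assms(4) by (simp add: fun_eq_iff sum_fscale_apply)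
  finally have "c (inv_into I t (t i)) = 0"
    using fun_space.independent_explicit_finite_subsets[THEN iffD1, OF assms(3), rule_format, of "t ` I"
        "\<lambda>v. c (inv_into I t v)" "t i"] assms(1,5)
    by simp
  then show ?thesis using assms(2,5) by simp
qed

text \<open>A generating family that is no longer than some independent family of the space is a
  basis: no member can be redundant and none can lie outside the span of the independent family,
  because of the exchange lemma.\<close>

lemma basis_by_counting:
  fixes t :: "'a \<Rightarrow> 'c \<Rightarrow> real" and P :: "'b \<Rightarrow> 'c \<Rightarrow> real"
  assumes fin: "finite I" "finite J" and card: "card J \<le> card I"
    and t: "inj_on t I" "fun_space.independent (t ` I)" "t ` I \<subseteq> S"
    and S: "fun_space.subspace S" "S \<subseteq> fun_space.span (P ` J)"
  shows "inj_on P J" "fun_space.independent (P ` J)" "fun_space.span (P ` J) = S"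
proof -
  let ?T = "t ` I" and ?W = "P ` J"
  have cardT: "card ?T = card I" using t(1) by (rule card_image)
  have cardW: "card ?W \<le> card J" using fin(2) by (rule card_image_le)
  have bound: "card U \<le> card V" if "finite V" "fun_space.independent U" "U \<subseteq> fun_space.span V"
    for U V :: "('c \<Rightarrow> real) set"
    using fun_space.independent_span_bound[OF that] by simp
  have TW: "?T \<subseteq> fun_space.span ?W" using t(3) S(2) by blast
  have eq: "card ?W = card J" "card J = card I"
    using bound[of ?W, OF _ t(2) TW] cardT cardW card fin(2) by simp_all
  then show "inj_on P J" by (simp add: eq_card_imp_inj_on fin(2))
  show "fun_space.independent ?W"
  proof
    assume "fun_space.dependent ?W"
    then obtain x where x: "x \<in> ?W" "x \<in> fun_space.span (?W - {x})"
      unfolding fun_space.dependent_def by blast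
    then have "fun_space.span ?W = fun_space.span (?W - {x})"
      by (metis fun_space.span_redundant insert_Diff)
    with TW have "?T \<subseteq> fun_space.span (?W - {x})" by simp
    from bound[of "?W - {x}", OF _ t(2) this] fin(2) have "card ?T \<le> card (?W - {x})" by simp
    also have "\<dots> < card ?W" using x(1) fin(2) by (intro card_Diff1_less) auto
    finally show False using eq cardT by simp
  qed
  have "?W \<subseteq> fun_space.span ?T"
  proof (rule ccontr)
    assume "\<not> ?W \<subseteq> fun_space.span ?T"
    then obtain x where x: "x \<in> ?W" "x \<notin> fun_space.span ?T" by blast
    then have "fun_space.independent (insert x ?T)"
      using t(2) by (intro fun_space.independent_insertI)
    moreover have "insert x ?T \<subseteq> fun_space.span ?W" using TW x by (auto intro: fun_space.span_base)
    ultimately have "card (insert x ?T) \<le> card ?W" using bound fin(2) by simp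
    moreover have "x \<notin> ?T" using x(2) fun_space.span_superset[of ?T] by blast
    ultimately show False using eq cardT fin(1) by simp
  qed
  moreover have "fun_space.span ?T \<subseteq> S" using t(3) S(1) by (rule fun_space.span_minimal)
  ultimately have "fun_space.span ?W \<subseteq> S"
    using S(1) by (intro fun_space.span_minimal) auto
  with S(2) show "fun_space.span ?W = S" by blast
qed

section \<open>Open knot sequences and their breakpoints\<close>

locale open_knot_sequence =
  fixes a b :: real and p n :: nat and \<xi> :: "nat \<Rightarrow> real"
  assumes open_knots: "open_knots a b p n \<xi>" and less: "a < b" and p_less_n: "p < n"
begin

abbreviation (input) "r \<equiv> num_breaks p n \<xi>"
abbreviation (input) "\<zeta> \<equiv> breakpoint p n \<xi>"
abbreviation (input) "\<mu> \<equiv> knot_mult p n \<xi>"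

lemma knots_mono: "1 \<le> i \<Longrightarrow> i \<le> j \<Longrightarrow> j \<le> n + p + 1 \<Longrightarrow> \<xi> i \<le> \<xi> j"
  using open_knots by (auto simp: open_knots_def mono_on_def)

lemma finite_knot_set: "finite (knot_set p n \<xi>)"
  by (simp add: knot_set_def)

lemma breakpoint_less: "1 \<le> i \<Longrightarrow> i < j \<Longrightarrow> j \<le> r \<Longrightarrow> \<zeta> i < \<zeta> j"
  using sorted_wrt_nth_less[OF strict_sorted_list_of_set, of "i - 1" "j - 1" "knot_set p n \<xi>"]
  by (auto simp: breakpoint_def num_breaks_def)

lemma breakpoint_mono: "1 \<le> i \<Longrightarrow> i \<le> j \<Longrightarrow> j \<le> r \<Longrightarrow> \<zeta> i \<le> \<zeta> j"
  using breakpoint_less[of i j] by (cases "i = j") auto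

lemma breakpoint_less_iff: "i \<in> {1..r} \<Longrightarrow> j \<in> {1..r} \<Longrightarrow> \<zeta> i < \<zeta> j \<longleftrightarrow> i < j"
  using breakpoint_less[of i j] breakpoint_mono[of j i] by force

lemma knot_set_eq_breakpoints: "knot_set p n \<xi> = \<zeta> ` {1..r}"
proof -
  have "knot_set p n \<xi> = set (sorted_list_of_set (knot_set p n \<xi>))"
    using finite_knot_set by simp
  also have "\<dots> = (\<lambda>j. sorted_list_of_set (knot_set p n \<xi>) ! j) ` {0..<r}"
    using finite_knot_set by (force simp: set_conv_nth num_breaks_def)
  also have "{0..<r} = (\<lambda>j. j - 1) ` {1..r}"
    by (force simp: image_iff intro!: bexI[of _ "Suc _"])
  finally show ?thesis unfolding image_image breakpoint_def[abs_def] .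
qed

lemma knot_is_breakpoint:
  assumes "1 \<le> i" "i \<le> n + p + 1"
  shows "\<exists>j\<in>{1..r}. \<xi> i = \<zeta> j"
proof -
  have "\<xi> i \<in> knot_set p n \<xi>" using assms by (auto simp: knot_set_def)
  then show ?thesis unfolding knot_set_eq_breakpoints by blast
qed

lemma breakpoint_first: "\<zeta> 1 = a" and breakpoint_last: "\<zeta> r = b"
  using open_knots by (auto simp: open_knots_def)

lemma num_breaks_ge_2: "2 \<le> r"
proof -
  have "r \<noteq> 0" using finite_knot_set by (auto simp: num_breaks_def knot_set_def)
  moreover have "r \<noteq> 1"
  proof
    assume "r = 1"
    then have "\<zeta> r = \<zeta> 1" by simp
    then show False using less breakpoint_first breakpoint_last by linarith
  qed
  ultimately show ?thesis by linarith
qed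

lemma breakpoint_bounds: "j \<in> {1..r} \<Longrightarrow> a \<le> \<zeta> j \<and> \<zeta> j \<le> b"
  using breakpoint_mono[of 1 j] breakpoint_mono[of j r]
  unfolding breakpoint_first breakpoint_last by simp

lemma knot_bounds: "1 \<le> i \<Longrightarrow> i \<le> n + p + 1 \<Longrightarrow> a \<le> \<xi> i \<and> \<xi> i \<le> b"
  using knot_is_breakpoint[of i] breakpoint_bounds by auto

lemma mult_le: "j \<in> {1..r} \<Longrightarrow> \<mu> j \<le> p + 1"
proof -
  assume j: "j \<in> {1..r}"
  consider "j = 1" | "j = r" | "j \<in> {2..r - 1}" using j by force
  then show ?thesis using open_knots unfolding open_knots_def by cases auto
qed

lemma next_knot: "j \<in> {1..r - 1} \<Longrightarrow> 1 \<le> i \<Longrightarrow> i \<le> n + p + 1 \<Longrightarrow> \<zeta> j < \<xi> i \<Longrightarrow> \<zeta> (j + 1) \<le> \<xi> i"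
proof -
  assume j: "j \<in> {1..r - 1}" and i: "1 \<le> i" "i \<le> n + p + 1" and "\<zeta> j < \<xi> i"
  from i obtain k where k: "k \<in> {1..r}" "\<xi> i = \<zeta> k" using knot_is_breakpoint by blast
  with \<open>\<zeta> j < \<xi> i\<close> j have "j < k" using breakpoint_less_iff[of j k] by auto
  then show ?thesis using k j breakpoint_mono[of "j + 1" k] by auto
qed

lemma breakpoint_interval:
  assumes "a \<le> x" "x < b"
  obtains j where "j \<in> {1..r - 1}" "\<zeta> j \<le> x" "x < \<zeta> (j + 1)"
proof -
  let ?A = "{j \<in> {1..r}. \<zeta> j \<le> x}"
  define j where "j = Max ?A"
  have "\<zeta> 1 \<le> x" using breakpoint_first assms(1) by simp
  moreover have "1 \<in> {1..r}" using num_breaks_ge_2 by simp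
  ultimately have "1 \<in> ?A" by blast
  then have "?A \<noteq> {}" by blast
  moreover have "finite ?A" by simp
  ultimately have j: "j \<in> ?A" unfolding j_def by (rule Max_in[rotated])
  have "j \<noteq> r" using j assms(2) breakpoint_last by force
  with j have jr: "j \<in> {1..r - 1}" by auto
  moreover have "x < \<zeta> (j + 1)"
  proof (rule ccontr)
    assume "\<not> x < \<zeta> (j + 1)"
    then have "j + 1 \<in> ?A" using jr by auto
    then have "j + 1 \<le> j" unfolding j_def by (rule Max_ge[OF \<open>finite ?A\<close>])
    then show False by simp
  qed
  ultimately show ?thesis using that j by blast
qed

lemma first_knots: "1 \<le> i \<Longrightarrow> i \<le> p + 1 \<Longrightarrow> \<xi> i = a"
proof (rule ccontr)
  assume i: "1 \<le> i" "i \<le> p + 1" and "\<xi> i \<noteq> a"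
  let ?A = "{k \<in> {1..n + p + 1}. \<xi> k = \<zeta> 1}"
  have "\<xi> k \<noteq> a" if "i \<le> k" "k \<le> n + p + 1" for k
    using knots_mono[of i k] knot_bounds[of i] that i \<open>\<xi> i \<noteq> a\<close> by linarith
  then have "k \<in> {1..<i}" if "k \<in> ?A" for k
    using that \<open>\<And>k. i \<le> k \<Longrightarrow> k \<le> n + p + 1 \<Longrightarrow> \<xi> k \<noteq> a\<close>[of k] unfolding breakpoint_first
    by (cases "k < i") auto
  then have "?A \<subseteq> {1..<i}" by blast
  then have "card ?A \<le> card {1..<i}" by (intro card_mono) auto
  moreover have "card ?A = p + 1"
    using open_knots unfolding open_knots_def knot_mult_def by auto
  ultimately show False using i by simp
qed

lemma last_knots: "n + 1 \<le> i \<Longrightarrow> i \<le> n + p + 1 \<Longrightarrow> \<xi> i = b"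
proof (rule ccontr)
  assume i: "n + 1 \<le> i" "i \<le> n + p + 1" and "\<xi> i \<noteq> b"
  let ?A = "{k \<in> {1..n + p + 1}. \<xi> k = \<zeta> r}"
  have "\<xi> k \<noteq> b" if "1 \<le> k" "k \<le> i" for k
    using knots_mono[of k i] knot_bounds[of i] that i \<open>\<xi> i \<noteq> b\<close> by linarith
  then have "k \<in> {i<..n + p + 1}" if "k \<in> ?A" for k
    using that \<open>\<And>k. 1 \<le> k \<Longrightarrow> k \<le> i \<Longrightarrow> \<xi> k \<noteq> b\<close>[of k] unfolding breakpoint_last
    by (cases "i < k") auto
  then have "?A \<subseteq> {i<..n + p + 1}" by blast
  then have "card ?A \<le> card {i<..n + p + 1}" by (intro card_mono) auto
  moreover have "card ?A = p + 1"
    using open_knots unfolding open_knots_def knot_mult_def by auto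
  ultimately show False using i by simp
qed

text \<open>Otherwise \<open>p + 2\<close> consecutive knots would coincide.\<close>

lemma knot_less_shift:
  assumes "1 \<le> i" "i \<le> n"
  shows "\<xi> i < \<xi> (i + p + 1)"
proof (rule ccontr)
  assume "\<not> ?thesis"
  then have eq: "\<xi> k = \<xi> i" if "i \<le> k" "k \<le> i + p + 1" for k
  proof -
    have "\<xi> i \<le> \<xi> k" "\<xi> k \<le> \<xi> (i + p + 1)" using that assms by (auto intro!: knots_mono)
    then show ?thesis using \<open>\<not> \<xi> i < \<xi> (i + p + 1)\<close> by linarith
  qed
  obtain j where j: "j \<in> {1..r}" "\<xi> i = \<zeta> j" using knot_is_breakpoint[of i] assms by auto
  have "{i..i + p + 1} \<subseteq> {k \<in> {1..n + p + 1}. \<xi> k = \<zeta> j}"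
    using eq j assms by auto
  then have "card {i..i + p + 1} \<le> \<mu> j" unfolding knot_mult_def by (intro card_mono) auto
  then show False using mult_le[OF j(1)] by simp
qed

lemma knot_less_right_end: "1 \<le> i \<Longrightarrow> i \<le> n \<Longrightarrow> \<xi> i < b"
  using knot_less_shift[of i] knot_bounds[of "i + p + 1"] by simp

subsection \<open>The spline space\<close>

definition spline_pieces :: "(real \<Rightarrow> real) \<Rightarrow> (nat \<Rightarrow> real poly) \<Rightarrow> bool" where
  "spline_pieces g h \<longleftrightarrow>
     (\<forall>j\<in>{1..r - 1}. degree (h j) \<le> p) \<and>
     (\<forall>j\<in>{1..r - 1}. \<forall>x\<in>{\<zeta> j..<\<zeta> (j + 1)}. g x = poly (h j) x) \<and>
     g b = poly (h (r - 1)) b \<and>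
     (\<forall>j\<in>{2..r - 1}. \<forall>l. l + \<mu> j \<le> p \<longrightarrow>
        poly ((pderiv ^^ l) (h (j - 1))) (\<zeta> j) = poly ((pderiv ^^ l) (h j)) (\<zeta> j))"

lemma spline_space_iff:
  "g \<in> spline_space a b p n \<xi> \<longleftrightarrow> (\<forall>x. x \<notin> {a..b} \<longrightarrow> g x = 0) \<and> (\<exists>h. spline_pieces g h)"
  by (simp add: spline_space_def Let_def spline_pieces_def)

lemma subspace_spline_space: "fun_space.subspace (spline_space a b p n \<xi>)"
proof (unfold fun_space.subspace_def, intro conjI ballI allI)
  show "0 \<in> spline_space a b p n \<xi>"
    unfolding spline_space_iff by (auto simp: spline_pieces_def intro!: exI[of _ "\<lambda>_. 0"])
next
  fix g g' assume "g \<in> spline_space a b p n \<xi>" "g' \<in> spline_space a b p n \<xi>"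
  then obtain h h' where "\<And>x. x \<notin> {a..b} \<Longrightarrow> g x = 0 \<and> g' x = 0"
    "spline_pieces g h" "spline_pieces g' h'"
    unfolding spline_space_iff by blast
  moreover from this have "spline_pieces (g + g') (\<lambda>j. h j + h' j)"
    by (simp add: spline_pieces_def higher_pderiv_add degree_add_le)
  ultimately show "g + g' \<in> spline_space a b p n \<xi>"
    unfolding spline_space_iff by auto
next
  fix c g assume "g \<in> spline_space a b p n \<xi>"
  then obtain h where "\<And>x. x \<notin> {a..b} \<Longrightarrow> g x = 0" "spline_pieces g h"
    unfolding spline_space_iff by blast
  moreover from this have "spline_pieces (fscale c g) (\<lambda>j. smult c (h j))"
    by (simp add: spline_pieces_def higher_pderiv_smult fscale_def)
  ultimately show "fscale c g \<in> spline_space a b p n \<xi>"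
    unfolding spline_space_iff by (auto simp: fscale_def)
qed

end

section \<open>Marsden's identity\<close>

lemma bspline_rec_support:
  assumes mono: "mono_on {1..K} \<xi>" and "1 \<le> i" "i + q + 1 \<le> K" and "bspline_rec \<xi> i q x \<noteq> 0"
  shows "\<xi> i \<le> x \<and> x < \<xi> (i + q + 1)"
  using assms(2-)
proof (induction q arbitrary: i)
  case 0
  then show ?case by (simp split: if_splits)
next
  case (Suc q)
  have "\<xi> i \<le> \<xi> (i + 1)" "\<xi> (i + q + 1) \<le> \<xi> (i + Suc q + 1)"
    using mono Suc.prems(1,2) by (auto simp: mono_on_def)
  moreover have "bspline_rec \<xi> i q x \<noteq> 0 \<or> bspline_rec \<xi> (i + 1) q x \<noteq> 0"
    using Suc.prems(3) by auto
  ultimately show ?case using Suc.IH[of i] Suc.IH[of "i + 1"] Suc.prems by auto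
qed

text \<open>The dual polynomials: in Marsden's identity they are the coefficients of the B-splines in the
  expansion of \<open>(y - x)^q\<close>, seen as a polynomial in \<open>y\<close>.\<close>

definition dual_poly :: "(nat \<Rightarrow> real) \<Rightarrow> nat \<Rightarrow> nat \<Rightarrow> real poly" where
  "dual_poly \<xi> i q = (\<Prod>j = 1..q. [:- \<xi> (i + j), 1:])"

lemma dual_poly_Suc: "dual_poly \<xi> i (Suc q) = [:- \<xi> (i + Suc q), 1:] * dual_poly \<xi> i q"
  by (simp add: dual_poly_def mult.commute)

lemma dual_poly_Suc_shift: "dual_poly \<xi> i (Suc q) = [:- \<xi> (Suc i), 1:] * dual_poly \<xi> (Suc i) q"
proof (induction q)
  case (Suc q)
  show ?case
    unfolding dual_poly_Suc[of \<xi> i "Suc q"] Suc.IH dual_poly_Suc[of \<xi> "Suc i" q]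
    by (simp add: mult_ac del: mult_pCons_left mult_pCons_right)
qed (simp add: dual_poly_def)

lemma degree_dual_poly: "degree (dual_poly \<xi> i q) = q"
  unfolding dual_poly_def by (subst degree_prod_eq_sum_degree) auto

lemma coeff_dual_poly: "coeff (dual_poly \<xi> i q) q = 1"
proof -
  have "lead_coeff (dual_poly \<xi> i q) = 1" unfolding dual_poly_def by (simp add: lead_coeff_prod)
  then show ?thesis by (simp add: degree_dual_poly)
qed

context open_knot_sequence begin

lemma bspline_support:
  "1 \<le> i \<Longrightarrow> i + q \<le> n + p \<Longrightarrow> bspline_rec \<xi> i q x \<noteq> 0 \<Longrightarrow> \<xi> i \<le> x \<and> x < \<xi> (i + q + 1)"
  using open_knots by (intro bspline_rec_support[of "n + p + 1"]) (auto simp: open_knots_def)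

text \<open>Induction on the degree. After the recurrence is inserted, every B-spline of degree \<open>q\<close>
  occurs twice, with weights \<open>\<alpha>\<close> and \<open>\<beta>\<close> and with two dual polynomials that share all
  factors but one; the weights are those for which the two remaining linear factors average to
  \<open>y - x\<close>. The two B-splines that occur once only are supported outside \<open>[a, b)\<close>,
  because the end knots have multiplicity \<open>p + 1\<close>.\<close>

lemma marsden:
  assumes "q \<le> p" "a \<le> x" "x < b"
  shows "(\<Sum>i = p + 1 - q..n. smult (bspline_rec \<xi> i q x) (dual_poly \<xi> i q)) = [:- x, 1:] ^ q"
  using assms(1)
proof (induction q)
  case 0
  obtain j where j: "j \<in> {p + 1..n}" "\<xi> j \<le> x" "x < \<xi> (j + 1)"
  proof -
    let ?A = "{j \<in> {p + 1..n}. \<xi> j \<le> x}"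
    have "p + 1 \<in> ?A" using first_knots[of "p + 1"] assms p_less_n by auto
    then have "Max ?A \<in> ?A" by (intro Max_in) auto
    moreover have "x < \<xi> (Max ?A + 1)"
    proof (rule ccontr)
      assume *: "\<not> x < \<xi> (Max ?A + 1)"
      have "Max ?A \<noteq> n" using * last_knots[of "n + 1"] assms by auto
      with * \<open>Max ?A \<in> ?A\<close> have "Max ?A + 1 \<in> ?A" by auto
      then have "Max ?A + 1 \<le> Max ?A" by (intro Max_ge) auto
      then show False by simp
    qed
    ultimately show ?thesis using that by blast
  qed
  have "bspline_rec \<xi> i 0 x = (if i = j then 1 else 0)" if "i \<in> {p + 1..n}" for i
    using that j knots_mono[of "i + 1" j] knots_mono[of "j + 1" i] by (cases i j rule: linorder_cases) auto
  then have "(\<Sum>i = p + 1..n. smult (bspline_rec \<xi> i 0 x) (dual_poly \<xi> i 0))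
      = (\<Sum>i = p + 1..n. if i = j then 1 else 0)"
    by (intro sum.cong) (auto simp: dual_poly_def simp del: bspline_rec.simps)
  then show ?case using j by simp
next
  case (Suc q)
  define \<alpha> where "\<alpha> i = (x - \<xi> i) / (\<xi> (i + Suc q) - \<xi> i)" for i
  define \<beta> where "\<beta> i = (\<xi> (i + Suc q) - x) / (\<xi> (i + Suc q) - \<xi> i)" for i
  define B where "B i = bspline_rec \<xi> i q x" for i
  define w where "w i = dual_poly \<xi> i (Suc q)" for i
  let ?m = "p - q"
  have m: "p + 1 - Suc q = ?m" "p + 1 - q = Suc ?m" "1 \<le> ?m" "?m \<le> n" using Suc.prems p_less_n by auto
  \<comment> \<open>The support of this B-spline ends at the knot \<open>\<xi> (p + 1) = a\<close>, the next one's begins at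
    \<open>\<xi> (n + 1) = b\<close>.\<close>
  have left: "B ?m = 0"
    using bspline_support[of ?m q x] first_knots[of "p + 1"] Suc.prems p_less_n assms(2) m
    by (force simp: B_def)
  have right: "B (n + 1) = 0"
    using bspline_support[of "n + 1" q x] last_knots[of "n + 1"] Suc.prems assms(3)
    by (force simp: B_def)
  have "(\<Sum>i = ?m..n. smult (bspline_rec \<xi> i (Suc q) x) (w i))
      = (\<Sum>i = ?m..n. smult (\<alpha> i * B i) (w i)) + (\<Sum>i = ?m..n. smult (\<beta> (Suc i) * B (Suc i)) (w i))"
    by (simp add: \<alpha>_def \<beta>_def B_def sum.distrib smult_add_left)
  also have "(\<Sum>i = ?m..n. smult (\<alpha> i * B i) (w i)) = (\<Sum>i = Suc ?m..n. smult (\<alpha> i * B i) (w i))"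
    using left m by (subst sum.atLeast_Suc_atMost) auto
  also have "(\<Sum>i = ?m..n. smult (\<beta> (Suc i) * B (Suc i)) (w i))
      = (\<Sum>i = Suc ?m..Suc n. smult (\<beta> i * B i) (w (i - 1)))"
    by (subst sum.shift_bounds_cl_Suc_ivl) simp
  also have "\<dots> = (\<Sum>i = Suc ?m..n. smult (\<beta> i * B i) (w (i - 1)))"
    using right m by simp
  also have "(\<Sum>i = Suc ?m..n. smult (\<alpha> i * B i) (w i)) + \<dots>
      = (\<Sum>i = Suc ?m..n. [:- x, 1:] * smult (B i) (dual_poly \<xi> i q))"
    unfolding sum.distrib[symmetric]
  proof (rule sum.cong)
    fix i assume i: "i \<in> {Suc ?m..n}"
    show "smult (\<alpha> i * B i) (w i) + smult (\<beta> i * B i) (w (i - 1)) = [:- x, 1:] * smult (B i) (dual_poly \<xi> i q)"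
    proof (cases "B i = 0")
      case False
      then have "\<xi> i < \<xi> (i + Suc q)"
        using bspline_support[of i q x] i Suc.prems by (auto simp: B_def)
      define d where "d = \<xi> (i + Suc q) - \<xi> i"
      have "d \<noteq> 0" using \<open>\<xi> i < \<xi> (i + Suc q)\<close> by (simp add: d_def)
      have "\<alpha> i + \<beta> i = d / d"
        by (simp add: \<alpha>_def \<beta>_def d_def add_divide_distrib[symmetric])
      moreover have "\<alpha> i * \<xi> (i + Suc q) + \<beta> i * \<xi> i = (x * d) / d"
        unfolding \<alpha>_def \<beta>_def d_def[symmetric] times_divide_eq_left add_divide_distrib[symmetric]
        by (simp add: d_def algebra_simps)
      ultimately have combine: "smult (\<alpha> i) [:- \<xi> (i + Suc q), 1:] + smult (\<beta> i) [:- \<xi> i, 1:] = [:- x, 1:]"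
        using \<open>d \<noteq> 0\<close> by simp
      have w: "w i = [:- \<xi> (i + Suc q), 1:] * dual_poly \<xi> i q"
        unfolding w_def by (rule dual_poly_Suc)
      have w': "w (i - 1) = [:- \<xi> i, 1:] * dual_poly \<xi> i q"
        using dual_poly_Suc_shift[of \<xi> "i - 1" q] i unfolding w_def by simp
      have "smult (\<alpha> i * B i) (w i) + smult (\<beta> i * B i) (w (i - 1))
          = smult (B i) ((smult (\<alpha> i) [:- \<xi> (i + Suc q), 1:] + smult (\<beta> i) [:- \<xi> i, 1:]) * dual_poly \<xi> i q)"
        unfolding w w' distrib_right smult_add_right mult_smult_left smult_smult by (simp only: mult.commute)
      then show ?thesis unfolding combine by (simp only: mult_smult_right)
    qed simp
  qed simp
  also have "\<dots> = [:- x, 1:] * (\<Sum>i = Suc ?m..n. smult (B i) (dual_poly \<xi> i q))"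
    by (simp only: sum_distrib_left)
  also have "\<dots> = [:- x, 1:] ^ Suc q"
    using Suc.IH Suc.prems m by (simp add: B_def)
  finally show ?case using m by (simp add: w_def)
qed

text \<open>Compare the coefficients of \<open>y^p\<close> in Marsden's identity: all dual polynomials are monic.\<close>

lemma partition_of_unity:
  assumes "a \<le> x" "x < b"
  shows "(\<Sum>i = 1..n. bspline_rec \<xi> i p x) = 1"
proof -
  have "coeff (\<Sum>i = 1..n. smult (bspline_rec \<xi> i p x) (dual_poly \<xi> i p)) p = coeff ([:- x, 1:] ^ p) p"
    using marsden[of p x] assms by simp
  then show ?thesis by (simp add: coeff_sum coeff_dual_poly coeff_linear_power)
qed

end

section \<open>The dual pairing of polynomials\<close>

text \<open>This is, up to the factor \<open>p!\<close>, the bilinear form behind the de Boor-Fix functionals. On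
  polynomials of degree at most \<open>p\<close> its value is a constant polynomial, so that it can be
  evaluated wherever this is convenient.\<close>

definition pairing :: "nat \<Rightarrow> real poly \<Rightarrow> real poly \<Rightarrow> real poly" where
  "pairing p w h = (\<Sum>k\<le>p. smult ((-1) ^ k) ((pderiv ^^ (p - k)) w * (pderiv ^^ k) h))"

lemma higher_pderiv_degree_less: "degree (w :: real poly) \<le> p \<Longrightarrow> (pderiv ^^ Suc p) w = 0"
  by (simp add: pderiv_eq_0_iff degree_higher_pderiv)

text \<open>The derivative is a telescoping sum whose two end terms contain a derivative of order
  \<open>p + 1\<close> of \<open>w\<close> or of \<open>h\<close>.\<close>

lemma pairing_constant:
  assumes "degree w \<le> p" "degree h \<le> p"
  shows "poly (pairing p w h) x = poly (pairing p w h) y"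
proof -
  \<comment> \<open>The \<open>k\<close>-th term of the derivative is \<open>T k - T (k + 1)\<close>.\<close>
  define T where "T k = smult ((-1) ^ k) ((pderiv ^^ (Suc p - k)) w * (pderiv ^^ k) h)" for k
  have "pderiv (pairing p w h) = (\<Sum>k<Suc p. T k - T (Suc k))"
    unfolding pairing_def higher_pderiv_sum[where n = 1, simplified] lessThan_Suc_atMost
    by (intro sum.cong) (auto simp: T_def pderiv_smult pderiv_mult Suc_diff_le smult_add_right mult.commute)
  also have "\<dots> = T 0 - T (Suc p)" by (rule sum_lessThan_telescope')
  also have "\<dots> = 0"
    using higher_pderiv_degree_less[OF assms(1)] higher_pderiv_degree_less[OF assms(2)]
    by (simp add: T_def del: funpow.simps)
  finally have "degree (pairing p w h) = 0" by (simp add: pderiv_eq_0_iff)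
  then show ?thesis by (auto elim: degree_eq_zeroE)
qed

lemma poly_pairing_sum_left:
  "poly (pairing p (\<Sum>i\<in>I. smult (c i) (w i)) h) x = (\<Sum>i\<in>I. c i * poly (pairing p (w i) h) x)"
proof -
  have "poly (pairing p (\<Sum>i\<in>I. smult (c i) (w i)) h) x
      = (\<Sum>k\<le>p. \<Sum>i\<in>I. c i * ((-1) ^ k * (poly ((pderiv ^^ (p - k)) (w i)) x * poly ((pderiv ^^ k) h) x)))"
    unfolding pairing_def higher_pderiv_sum higher_pderiv_smult
    by (simp add: poly_sum sum_distrib_right sum_distrib_left algebra_simps)
  also have "\<dots> = (\<Sum>i\<in>I. c i * poly (pairing p (w i) h) x)"
    unfolding pairing_def by (subst sum.swap) (simp add: poly_sum sum_distrib_left)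
  finally show ?thesis .
qed

lemma higher_pderiv_linear_power:
  "k \<le> m \<Longrightarrow> (pderiv ^^ k) ([:- x, 1:] ^ m) = smult (fact m / fact (m - k)) ([:- x, 1 :: real:] ^ (m - k))"
proof (induction k)
  case (Suc k)
  then obtain l where l: "m - k = Suc l" "m - Suc k = l" by (metis Suc_diff_Suc Suc_le_lessD)
  have "(pderiv ^^ Suc k) ([:- x, 1:] ^ m) = pderiv (smult (fact m / fact (Suc l)) ([:- x, 1:] ^ Suc l))"
    using Suc l by simp
  also have "\<dots> = smult (fact m / fact l) ([:- x, 1:] ^ l)"
  proof -
    have "fact m / fact (Suc l) * real (Suc l) = (fact m / fact l :: real)"
      by (simp add: fact_Suc del: of_nat_Suc)
    then show ?thesis unfolding pderiv_smult pderiv_power_Suc by (simp add: pderiv_pCons del: fact_Suc of_nat_Suc)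
  qed
  finally show ?case using l by simp
qed simp

text \<open>At the point \<open>x\<close> only the derivative of full order of \<open>(y - x)^p\<close> does not vanish.
  Pairing Marsden's identity with \<open>h\<close> therefore writes the value \<open>h(x)\<close> as a combination
  of the B-spline values at \<open>x\<close>.\<close>

lemma pairing_linear_power: "poly (pairing p ([:- x, 1:] ^ p) h) x = fact p * poly h x"
proof -
  have "poly (pairing p ([:- x, 1:] ^ p) h) x = (\<Sum>k\<le>p. if k = 0 then fact p * poly h x else 0)"
    unfolding pairing_def poly_sum
    by (intro sum.cong) (auto simp: higher_pderiv_linear_power poly_power power_0_left)
  then show ?thesis by simp
qed

lemma power_dvd_higher_pderiv:
  assumes "[:- c, 1:] ^ m dvd (w :: real poly)"
  shows "[:- c, 1:] ^ (m - k) dvd (pderiv ^^ k) w"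
proof (induction k)
  case (Suc k)
  show ?case
  proof (cases "m - k")
    case (Suc l)
    define L where "L = [:- c, 1:]"
    have "pderiv L = 1" by (simp add: L_def pderiv_pCons)
    obtain u where "(pderiv ^^ k) w = L ^ Suc l * u"
      using Suc.IH Suc unfolding L_def by (metis dvdE)
    moreover have "pderiv (L ^ Suc l) = smult (of_nat (Suc l)) (L ^ l)"
      unfolding pderiv_power_Suc \<open>pderiv L = 1\<close> by simp
    ultimately have "pderiv ((pderiv ^^ k) w) = L ^ l * (smult (of_nat (Suc l)) u + L * pderiv u)"
      by (simp only: pderiv_mult) (simp add: algebra_simps del: of_nat_Suc)
    moreover have "m - Suc k = l" using Suc by simp
    ultimately show ?thesis unfolding L_def by simp
  qed (simp add: diff_Suc)
qed (use assms in simp)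

lemma higher_pderiv_vanishes:
  assumes "[:- c, 1:] ^ m dvd (w :: real poly)" "k < m"
  shows "poly ((pderiv ^^ k) w) c = 0"
proof -
  have "[:- c, 1:] dvd [:- c, 1:] ^ (m - k)" using assms(2) by (intro dvd_power) auto
  also have "\<dots> dvd (pderiv ^^ k) w" using assms(1) by (rule power_dvd_higher_pderiv)
  finally show ?thesis by (simp add: poly_eq_0_iff_dvd)
qed

section \<open>Splines are combinations of B-splines\<close>

context open_knot_sequence begin

text \<open>Every copy of a breakpoint strictly between the end knots of a B-spline is one of its inner
  knots, and these are the roots of the dual polynomial.\<close>

lemma breakpoint_power_dvd_dual_poly:
  assumes i: "1 \<le> i" "i \<le> n" and j: "\<xi> i < \<zeta> j" "\<zeta> j < \<xi> (i + p + 1)"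
  shows "[:- \<zeta> j, 1:] ^ \<mu> j dvd dual_poly \<xi> i p"
proof -
  let ?A = "{k \<in> {1..p}. \<xi> (i + k) = \<zeta> j}"
  have "{k \<in> {1..n + p + 1}. \<xi> k = \<zeta> j} = (\<lambda>k. i + k) ` ?A" (is "?B = _")
  proof
    show "?B \<subseteq> (\<lambda>k. i + k) ` ?A"
    proof
      fix k assume k: "k \<in> ?B"
      have "i < k" using k knots_mono[of k i] i j by force
      moreover have "k < i + p + 1" using k knots_mono[of "i + p + 1" k] i j by force
      ultimately show "k \<in> (\<lambda>k. i + k) ` ?A" using k by (intro image_eqI[of _ _ "k - i"]) auto
    qed
    show "(\<lambda>k. i + k) ` ?A \<subseteq> ?B" using i by auto
  qed
  then have "\<mu> j = card ?A" unfolding knot_mult_def by (simp add: card_image)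
  then have "[:- \<zeta> j, 1:] ^ \<mu> j = (\<Prod>k\<in>?A. [:- \<xi> (i + k), 1:])" by simp
  also have "\<dots> dvd dual_poly \<xi> i p" unfolding dual_poly_def by (intro prod_dvd_prod_subset) auto
  finally show ?thesis .
qed

text \<open>The pairing is evaluated at the common breakpoint of the two pieces. Its terms contain either a
  derivative of the pieces of an order for which they agree, or a derivative of the dual polynomial
  of order less than the multiplicity of the breakpoint, which is zero there. So the smoothness
  conditions of the spline space are exactly what makes the functional independent of the piece.\<close>

lemma dual_functional_step:
  assumes h: "spline_pieces g h" and i: "1 \<le> i" "i \<le> n" and j: "1 \<le> j" "j + 1 \<le> r - 1"
    and win: "\<xi> i \<le> \<zeta> j" "\<zeta> (j + 2) \<le> \<xi> (i + p + 1)"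
  shows "poly (pairing p (dual_poly \<xi> i p) (h j)) 0 = poly (pairing p (dual_poly \<xi> i p) (h (j + 1))) 0"
proof -
  let ?w = "dual_poly \<xi> i p" and ?c = "\<zeta> (j + 1)"
  have "\<zeta> j < ?c" "?c < \<zeta> (j + 2)" using breakpoint_less[of j "j + 1"] breakpoint_less[of "j + 1" "j + 2"] j by auto
  then have dvd: "[:- ?c, 1:] ^ \<mu> (j + 1) dvd ?w"
    using i win by (intro breakpoint_power_dvd_dual_poly) auto
  have deg: "degree (h j) \<le> p" "degree (h (j + 1)) \<le> p" "degree ?w \<le> p"
    using h j by (auto simp: spline_pieces_def degree_dual_poly)
  have smooth: "poly ((pderiv ^^ k) (h j)) ?c = poly ((pderiv ^^ k) (h (j + 1))) ?c" if "k + \<mu> (j + 1) \<le> p" for k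
  proof -
    have "j + 1 \<in> {2..r - 1}" using j by auto
    with h that have "poly ((pderiv ^^ k) (h (j + 1 - 1))) ?c = poly ((pderiv ^^ k) (h (j + 1))) ?c"
      unfolding spline_pieces_def by blast
    then show ?thesis by simp
  qed
  have "poly (pairing p ?w (h j)) ?c = poly (pairing p ?w (h (j + 1))) ?c"
    unfolding pairing_def poly_sum
  proof (rule sum.cong)
    fix k assume "k \<in> {..p}"
    show "poly (smult ((- 1) ^ k) ((pderiv ^^ (p - k)) ?w * (pderiv ^^ k) (h j))) ?c =
      poly (smult ((- 1) ^ k) ((pderiv ^^ (p - k)) ?w * (pderiv ^^ k) (h (j + 1)))) ?c"
    proof (cases "k + \<mu> (j + 1) \<le> p")
      case True
      then show ?thesis using smooth by simp
    next
      case False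
      then have "poly ((pderiv ^^ (p - k)) ?w) ?c = 0"
        using \<open>k \<in> {..p}\<close> by (intro higher_pderiv_vanishes[OF dvd]) auto
      then show ?thesis by simp
    qed
  qed simp
  then show ?thesis using pairing_constant deg by metis
qed

lemma dual_functional_chain:
  assumes h: "spline_pieces g h" and i: "1 \<le> i" "i \<le> n" and jk: "1 \<le> j" "j \<le> k" "k \<le> r - 1"
    and win: "\<xi> i \<le> \<zeta> j" "\<zeta> (k + 1) \<le> \<xi> (i + p + 1)"
  shows "poly (pairing p (dual_poly \<xi> i p) (h j)) 0 = poly (pairing p (dual_poly \<xi> i p) (h k)) 0"
  using jk(2,3) win(2)
proof (induction k rule: dec_induct)
  case (step l)
  have "\<zeta> (l + 1) \<le> \<zeta> (Suc l + 1)" using step jk by (intro breakpoint_mono) auto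
  then have "poly (pairing p (dual_poly \<xi> i p) (h j)) 0 = poly (pairing p (dual_poly \<xi> i p) (h l)) 0"
    using step by (intro step.IH) auto
  moreover have "\<zeta> j \<le> \<zeta> l" using step jk by (intro breakpoint_mono) auto
  then have "poly (pairing p (dual_poly \<xi> i p) (h l)) 0 = poly (pairing p (dual_poly \<xi> i p) (h (l + 1))) 0"
    using step jk win(1) i by (intro dual_functional_step[OF h]) auto
  ultimately show ?case by simp
qed simp

text \<open>The coefficient of the \<open>i\<close>-th B-spline is its dual functional at the piece that starts at
  \<open>\<xi> i\<close>. At a given \<open>x\<close> the pairing with the piece containing \<open>x\<close> is what is
  needed; for each B-spline that does not vanish at \<open>x\<close> both pieces lie in its support, so the
  two pairings are equal.\<close>

lemma spline_eq_bspline_sum_interior: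
  assumes h: "spline_pieces g h"
  obtains c where "\<And>x. a \<le> x \<Longrightarrow> x < b \<Longrightarrow> g x = (\<Sum>i = 1..n. c i * bspline_rec \<xi> i p x)"
proof -
  let ?L = "\<lambda>i j. poly (pairing p (dual_poly \<xi> i p) (h j)) 0"
  have "\<exists>j. j \<in> {1..r} \<and> \<xi> i = \<zeta> j" if "i \<in> {1..n}" for i
    using that knot_is_breakpoint[of i] by auto
  then obtain s where s: "\<And>i. i \<in> {1..n} \<Longrightarrow> s i \<in> {1..r} \<and> \<xi> i = \<zeta> (s i)" by metis
  define c where "c i = ?L i (s i) / fact p" for i
  have "g x = (\<Sum>i = 1..n. c i * bspline_rec \<xi> i p x)" if x: "a \<le> x" "x < b" for x
  proof -
    obtain j where j: "j \<in> {1..r - 1}" "\<zeta> j \<le> x" "x < \<zeta> (j + 1)"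
      using x by (rule breakpoint_interval)
    have deg: "degree (h j) \<le> p" and gx: "g x = poly (h j) x"
      using h j unfolding spline_pieces_def by auto
    have "fact p * g x = poly (pairing p (\<Sum>i = 1..n. smult (bspline_rec \<xi> i p x) (dual_poly \<xi> i p)) (h j)) x"
      using marsden[of p x] x pairing_linear_power[of p x "h j"] gx by simp
    also have "\<dots> = (\<Sum>i = 1..n. bspline_rec \<xi> i p x * poly (pairing p (dual_poly \<xi> i p) (h j)) x)"
      by (simp add: poly_pairing_sum_left)
    also have "\<dots> = (\<Sum>i = 1..n. bspline_rec \<xi> i p x * ?L i (s i))"
    proof (rule sum.cong)
      fix i assume i: "i \<in> {1..n}"
      show "bspline_rec \<xi> i p x * poly (pairing p (dual_poly \<xi> i p) (h j)) x = bspline_rec \<xi> i p x * ?L i (s i)"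
      proof (cases "bspline_rec \<xi> i p x = 0")
        case False
        then have supp: "\<xi> i \<le> x" "x < \<xi> (i + p + 1)" using bspline_support[of i p x] i by auto
        have lo: "\<zeta> (s i) \<le> \<zeta> j"
          using next_knot[of j i] supp(1) j s[OF i] i by fastforce
        have hi: "\<zeta> (j + 1) \<le> \<xi> (i + p + 1)"
          using next_knot[of j "i + p + 1"] supp(2) j i by auto
        have "j \<in> {1..r}" using j(1) by auto
        then have "s i \<le> j" using lo breakpoint_less_iff[of j "s i"] s[OF i] by auto
        then have "?L i (s i) = ?L i j"
          using s[OF i] i j hi by (intro dual_functional_chain[OF h]) auto
        moreover have "poly (pairing p (dual_poly \<xi> i p) (h j)) x = ?L i j"
          using deg by (intro pairing_constant) (auto simp: degree_dual_poly)
        ultimately show ?thesis by simp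
      qed simp
    qed simp
    also have "\<dots> = fact p * (\<Sum>i = 1..n. c i * bspline_rec \<xi> i p x)"
      by (simp add: c_def sum_distrib_left mult.commute)
    finally show ?thesis by simp
  qed
  then show ?thesis by (rule that)
qed

text \<open>The value of a B-spline at the right end is defined by \<^const>\<open>Lim\<close>, which is
  meaningful only if the limit exists.\<close>

lemma bspline_rec_left_limit: "\<exists>L. (bspline_rec \<eta> i q \<longlongrightarrow> L) (at_left c)"
proof (induction q arbitrary: i)
  case 0
  consider "\<eta> i < c" "c \<le> \<eta> (i + 1)" | "c \<le> \<eta> i" | "\<eta> (i + 1) < c" by linarith
  then show ?case
  proof cases
    case 1
    have "eventually (\<lambda>x. bspline_rec \<eta> i 0 x = 1) (at_left c)"
      using eventually_at_left_real[OF 1(1)] by eventually_elim (use 1 in auto)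
    then show ?thesis by (intro exI[of _ 1] tendsto_eventually)
  next
    case 2
    have "c - 1 < c" by simp
    from eventually_at_left_real[OF this] have "eventually (\<lambda>x. bspline_rec \<eta> i 0 x = 0) (at_left c)"
      by eventually_elim (use 2 in auto)
    then show ?thesis by (intro exI[of _ 0] tendsto_eventually)
  next
    case 3
    have "eventually (\<lambda>x. bspline_rec \<eta> i 0 x = 0) (at_left c)"
      using eventually_at_left_real[OF 3] by eventually_elim auto
    then show ?thesis by (intro exI[of _ 0] tendsto_eventually)
  qed
next
  case (Suc q)
  then obtain L L' where
    L: "(bspline_rec \<eta> i q \<longlongrightarrow> L) (at_left c)" "(bspline_rec \<eta> (i + 1) q \<longlongrightarrow> L') (at_left c)" by blast
  have "((\<lambda>x. (x - \<eta> i) * C * bspline_rec \<eta> i q x + (\<eta> (i + Suc q + 1) - x) * C' * bspline_rec \<eta> (i + 1) q x)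
      \<longlongrightarrow> (c - \<eta> i) * C * L + (\<eta> (i + Suc q + 1) - c) * C' * L') (at_left c)" for C C'
    by (intro tendsto_add tendsto_mult tendsto_diff tendsto_ident_at tendsto_const L)
  then show ?case unfolding bspline_rec.simps(2)[abs_def] divide_inverse by blast
qed

lemma bspline_tendsto_right_end: "(bspline_rec \<xi> i q \<longlongrightarrow> bspline b \<xi> i q b) (at_left b)"
proof -
  obtain L where L: "(bspline_rec \<xi> i q \<longlongrightarrow> L) (at_left b)" using bspline_rec_left_limit by blast
  then have "Lim (at_left b) (bspline_rec \<xi> i q) = L" by (intro tendsto_Lim) auto
  with L show ?thesis by (simp add: bspline_def)
qed

lemma bspline_eq_rec: "x \<noteq> b \<Longrightarrow> bspline b \<xi> i q x = bspline_rec \<xi> i q x"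
  by (simp add: bspline_def)

lemma eq_bspline_sum_right_end:
  assumes eq: "\<And>x. a \<le> x \<Longrightarrow> x < b \<Longrightarrow> g x = (\<Sum>i = 1..n. c i * bspline_rec \<xi> i p x)"
    and lim: "(g \<longlongrightarrow> g b) (at_left b)"
  shows "g b = (\<Sum>i = 1..n. c i * bspline b \<xi> i p b)"
proof (rule tendsto_unique[OF trivial_limit_at_left_real lim])
  have "((\<lambda>x. \<Sum>i = 1..n. c i * bspline_rec \<xi> i p x) \<longlongrightarrow> (\<Sum>i = 1..n. c i * bspline b \<xi> i p b)) (at_left b)"
    by (intro tendsto_intros bspline_tendsto_right_end)
  moreover have "eventually (\<lambda>x. (\<Sum>i = 1..n. c i * bspline_rec \<xi> i p x) = g x) (at_left b)"
    using eventually_at_left_real[OF less] by eventually_elim (use eq in auto)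
  ultimately show "(g \<longlongrightarrow> (\<Sum>i = 1..n. c i * bspline b \<xi> i p b)) (at_left b)"
    by (rule Lim_transform_eventually)
qed

lemma spline_tendsto_right_end:
  assumes h: "spline_pieces g h"
  shows "(g \<longlongrightarrow> g b) (at_left b)"
proof -
  have "r - 1 \<in> {1..r - 1}" using num_breaks_ge_2 by auto
  moreover have "\<zeta> (r - 1 + 1) = b" using num_breaks_ge_2 breakpoint_last by simp
  ultimately have piece: "\<forall>x\<in>{\<zeta> (r - 1)..<b}. g x = poly (h (r - 1)) x"
    using h unfolding spline_pieces_def by metis
  have "\<zeta> (r - 1) < b" using breakpoint_less[of "r - 1" r] num_breaks_ge_2 breakpoint_last by simp
  from eventually_at_left_real[OF this] have "eventually (\<lambda>x. poly (h (r - 1)) x = g x) (at_left b)"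
    by eventually_elim (use piece in auto)
  moreover have "(poly (h (r - 1)) \<longlongrightarrow> poly (h (r - 1)) b) (at_left b)"
    by (intro tendsto_intros)
  ultimately have "(g \<longlongrightarrow> poly (h (r - 1)) b) (at_left b)"
    by (rule Lim_transform_eventually[rotated])
  then show ?thesis using h by (simp add: spline_pieces_def)
qed

lemma partition_of_unity_bspline:
  assumes "x \<in> {a..b}"
  shows "(\<Sum>i = 1..n. bspline b \<xi> i p x) = 1"
proof (cases "x = b")
  case True
  then show ?thesis
    using eq_bspline_sum_right_end[of "\<lambda>_. 1" "\<lambda>_. 1"] partition_of_unity by simp
next
  case False
  then show ?thesis using assms partition_of_unity[of x] by (simp add: bspline_eq_rec)
qed

lemma spline_eq_bspline_sum:
  assumes "g \<in> spline_space a b p n \<xi>"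
  obtains c where "\<And>x. x \<in> {a..b} \<Longrightarrow> g x = (\<Sum>i = 1..n. c i * bspline b \<xi> i p x)"
proof -
  obtain h where h: "spline_pieces g h" using assms by (auto simp: spline_space_iff)
  obtain c where c: "\<And>x. a \<le> x \<Longrightarrow> x < b \<Longrightarrow> g x = (\<Sum>i = 1..n. c i * bspline_rec \<xi> i p x)"
    by (rule spline_eq_bspline_sum_interior[OF h]) blast
  have "g x = (\<Sum>i = 1..n. c i * bspline b \<xi> i p x)" if "x \<in> {a..b}" for x
  proof (cases "x = b")
    case True
    then show ?thesis using eq_bspline_sum_right_end[OF c spline_tendsto_right_end[OF h]] by simp
  qed (use that c in \<open>auto simp: bspline_eq_rec\<close>)
  then show ?thesis by (rule that)
qed

text \<open>The entries of \<open>P\<^sub>k\<close>, indexed from 1 and extended by zero outside \<open>[a, b]\<close>.\<close>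

definition aux_spline :: "nat \<Rightarrow> real \<Rightarrow> real" where
  "aux_spline i x = (if x \<in> {a..b} then if i = 1 then 1 else bspline b \<xi> i p x else 0)"

text \<open>By the partition of unity the first B-spline is \<open>1\<close> minus the others, so replacing it by the
  constant function loses nothing.\<close>

lemma spline_space_subset_span: "spline_space a b p n \<xi> \<subseteq> fun_space.span (aux_spline ` {1..n})"
proof
  fix g assume g: "g \<in> spline_space a b p n \<xi>"
  then obtain c where c: "\<And>x. x \<in> {a..b} \<Longrightarrow> g x = (\<Sum>i = 1..n. c i * bspline b \<xi> i p x)"
    by (rule spline_eq_bspline_sum) blast
  \<comment> \<open>\<open>c 1\<close> times the first B-spline is \<open>c 1\<close> minus \<open>c 1\<close> times each of the others.\<close>
  define d where "d i = (if i = 1 then c 1 else c i - c 1)" for i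
  have head: "(\<Sum>i = 1..n. F i) = F 1 + (\<Sum>i = 2..n. F i)" for F :: "nat \<Rightarrow> real"
    using p_less_n by (subst sum.atLeast_Suc_atMost) (auto simp: numeral_2_eq_2)
  have "g x = (\<Sum>i = 1..n. d i * aux_spline i x)" for x
  proof (cases "x \<in> {a..b}")
    case True
    have one: "bspline b \<xi> 1 p x = 1 - (\<Sum>i = 2..n. bspline b \<xi> i p x)"
      using partition_of_unity_bspline[OF True] unfolding head by simp
    have "(\<Sum>i = 1..n. d i * aux_spline i x) = c 1 + (\<Sum>i = 2..n. (c i - c 1) * bspline b \<xi> i p x)"
      using True unfolding head by (simp add: d_def aux_spline_def)
    also have "\<dots> = (\<Sum>i = 1..n. c i * bspline b \<xi> i p x)"
      unfolding head one by (simp add: algebra_simps sum_subtractf sum_distrib_left)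
    finally show ?thesis using c[OF True] by simp
  next
    case False
    then have "aux_spline i x = 0" for i by (simp only: aux_spline_def if_False)
    moreover have "g x = 0" using g False unfolding spline_space_iff by blast
    ultimately show ?thesis by simp
  qed
  then have "g = (\<Sum>i = 1..n. fscale (d i) (aux_spline i))" by (simp add: fun_eq_iff sum_fscale_apply)
  then show "g \<in> fun_space.span (aux_spline ` {1..n})"
    unfolding span_family_iff[OF finite_atLeastAtMost] by blast
qed

section \<open>Truncated powers bound the dimension from below\<close>

text \<open>The truncated powers \<open>(x - \<zeta>)\<^sub>+^(p - l)\<close>, with \<open>l < m\<close> for a knot \<open>\<zeta>\<close> of
  multiplicity \<open>m\<close>, are indexed by the first \<open>n\<close> knots: \<open>l\<close> counts the earlier copies
  of the knot. The left end point, of multiplicity \<open>p + 1\<close>, contributes all polynomials of degree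
  at most \<open>p\<close>; the copies of the right end point are left out.\<close>

definition trunc_exp :: "nat \<Rightarrow> nat" where
  "trunc_exp i = p - card {k \<in> {1..<i}. \<xi> k = \<xi> i}"

definition trunc_power :: "nat \<Rightarrow> real \<Rightarrow> real" where
  "trunc_power i x = (if x \<in> {a..b} \<and> \<xi> i \<le> x then (x - \<xi> i) ^ trunc_exp i else 0)"

lemma card_earlier_copies:
  assumes "1 \<le> i" "i \<le> n"
  shows "card {k \<in> {1..<i}. \<xi> k = \<xi> i} \<le> p"
    and "j \<in> {1..r} \<Longrightarrow> \<xi> i = \<zeta> j \<Longrightarrow> card {k \<in> {1..<i}. \<xi> k = \<xi> i} < \<mu> j"
proof -
  show lt: "card {k \<in> {1..<i}. \<xi> k = \<xi> i} < \<mu> j" if "j \<in> {1..r}" "\<xi> i = \<zeta> j" for j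
  proof -
    let ?A = "{k \<in> {1..<i}. \<xi> k = \<xi> i}" and ?B = "{k \<in> {1..n + p + 1}. \<xi> k = \<zeta> j}"
    have "?A \<subseteq> ?B" "i \<in> ?B" "i \<notin> ?A" using assms that(2) by auto
    then have "?A \<subset> ?B" by blast
    then show ?thesis unfolding knot_mult_def by (intro psubset_card_mono) simp_all
  qed
  obtain j where j: "j \<in> {1..r}" "\<xi> i = \<zeta> j" using knot_is_breakpoint[of i] assms by auto
  show "card {k \<in> {1..<i}. \<xi> k = \<xi> i} \<le> p" using lt[OF j] mult_le[OF j(1)] by simp
qed

lemma trunc_exp_inj:
  assumes "1 \<le> i" "i \<le> n" "1 \<le> k" "k \<le> n" "\<xi> i = \<xi> k" "trunc_exp i = trunc_exp k"
  shows "i = k"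
proof -
  have less: "trunc_exp k < trunc_exp i" if "i < k" "1 \<le> i" "k \<le> n" "\<xi> i = \<xi> k" for i k
  proof -
    let ?A = "{l \<in> {1..<i}. \<xi> l = \<xi> i}" and ?B = "{l \<in> {1..<k}. \<xi> l = \<xi> k}"
    have "?A \<subseteq> ?B" "i \<in> ?B" "i \<notin> ?A" using that by auto
    then have "?A \<subset> ?B" by blast
    then have "card ?A < card ?B" by (intro psubset_card_mono) simp_all
    moreover have "card {l \<in> {1..<k}. \<xi> l = \<xi> k} \<le> p" using that by (intro card_earlier_copies) auto
    ultimately show ?thesis by (simp add: trunc_exp_def)
  qed
  show ?thesis using less[of i k] less[of k i] assms by (cases i k rule: linorder_cases) auto
qed

text \<open>The two polynomials that meet at the knot \<open>\<xi> i\<close> differ by a power of \<open>x - \<xi> i\<close> whose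
  exponent exceeds the order of smoothness required there.\<close>

lemma trunc_power_in_spline_space:
  assumes i: "1 \<le> i" "i \<le> n"
  shows "trunc_power i \<in> spline_space a b p n \<xi>"
proof -
  define e where "e = trunc_exp i"
  obtain s where s: "s \<in> {1..r}" "\<xi> i = \<zeta> s" using knot_is_breakpoint[of i] i by auto
  define h where "h j = (if s \<le> j then [:- \<xi> i, 1:] ^ e else 0)" for j
  have poly_h: "poly (h j) x = (if s \<le> j then (x - \<xi> i) ^ e else 0)" for j x
    by (simp add: h_def poly_power)
  have "spline_pieces (trunc_power i) h"
    unfolding spline_pieces_def
  proof (intro conjI ballI allI impI)
    fix j assume j: "j \<in> {1..r - 1}"
    show "degree (h j) \<le> p" by (simp add: h_def degree_linear_power e_def trunc_exp_def)
    fix x assume x: "x \<in> {\<zeta> j..<\<zeta> (j + 1)}"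
    have "a \<le> \<zeta> j" "\<zeta> (j + 1) \<le> b" using breakpoint_bounds[of j] breakpoint_bounds[of "j + 1"] j by auto
    then have "x \<in> {a..b}" using x by auto
    moreover have "\<xi> i \<le> x \<longleftrightarrow> s \<le> j"
    proof
      assume "\<xi> i \<le> x"
      then have "\<zeta> s < \<zeta> (j + 1)" using x s by auto
      moreover have "j + 1 \<in> {1..r}" using j by auto
      ultimately show "s \<le> j" using breakpoint_less_iff[of s "j + 1"] s by simp
    next
      assume "s \<le> j"
      moreover have "j \<le> r" using j by auto
      ultimately have "\<zeta> s \<le> \<zeta> j" using breakpoint_mono[of s j] s by simp
      then show "\<xi> i \<le> x" using s x by simp
    qed
    ultimately show "trunc_power i x = poly (h j) x" by (simp add: trunc_power_def poly_h e_def)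
  next
    have "s \<le> r - 1" using s knot_less_right_end[OF i] breakpoint_last by (cases "s = r") auto
    then show "trunc_power i b = poly (h (r - 1)) b"
      using knot_less_right_end[OF i] less by (simp add: trunc_power_def poly_h e_def)
  next
    fix j l assume j: "j \<in> {2..r - 1}" and l: "l + \<mu> j \<le> p"
    show "poly ((pderiv ^^ l) (h (j - 1))) (\<zeta> j) = poly ((pderiv ^^ l) (h j)) (\<zeta> j)"
    proof (cases "s = j")
      case True
      have "l < e"
        using l card_earlier_copies(2)[OF i s] True by (simp add: e_def trunc_exp_def)
      then have "poly ((pderiv ^^ l) ([:- \<zeta> j, 1:] ^ e)) (\<zeta> j) = 0"
        by (intro higher_pderiv_vanishes[of _ e]) auto
      then show ?thesis using True s j by (simp add: h_def)
    next
      case False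
      then have "s \<le> j - 1 \<longleftrightarrow> s \<le> j" by auto
      then show ?thesis by (simp add: h_def)
    qed
  qed
  moreover have "trunc_power i x = 0" if "x \<notin> {a..b}" for x
    using that unfolding trunc_power_def by (simp only: simp_thms if_False)
  ultimately show ?thesis unfolding spline_space_iff by blast
qed

text \<open>Take the first index \<open>m\<close> with a nonzero coefficient. Just to the right of \<open>\<xi> m\<close> only
  the truncated powers at this knot are left, and they are distinct powers of \<open>x - \<xi> m\<close>.\<close>

lemma trunc_powers_independent:
  assumes zero: "\<And>x. (\<Sum>i = 1..n. c i * trunc_power i x) = 0" and i: "i \<in> {1..n}"
  shows "c i = 0"
proof (rule ccontr)
  assume "c i \<noteq> 0"
  define m where "m = (LEAST m. m \<in> {1..n} \<and> c m \<noteq> 0)"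
  have m: "m \<in> {1..n}" "c m \<noteq> 0"
    using LeastI[of "\<lambda>m. m \<in> {1..n} \<and> c m \<noteq> 0" i] i \<open>c i \<noteq> 0\<close> unfolding m_def by auto
  have least: "c k = 0" if "k \<in> {1..n}" "k < m" for k
    using not_less_Least[of k "\<lambda>m. m \<in> {1..n} \<and> c m \<noteq> 0"] that unfolding m_def by auto
  obtain s where s: "s \<in> {1..r}" "\<xi> m = \<zeta> s" using knot_is_breakpoint[of m] m by auto
  have "s \<noteq> r" using s knot_less_right_end[of m] m breakpoint_last by auto
  with s have s1: "s \<in> {1..r - 1}" by auto
  have lt: "\<zeta> s < \<zeta> (s + 1)" using breakpoint_less[of s "s + 1"] s1 by auto
  let ?I = "{k \<in> {1..n}. \<xi> k = \<zeta> s}"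
  define q where "q = (\<Sum>k\<in>?I. Polynomial.monom (c k) (trunc_exp k))"
  have "poly q y = 0" if y: "y \<in> {0<..<\<zeta> (s + 1) - \<zeta> s}" for y
  proof -
    define x where "x = \<zeta> s + y"
    have x: "\<zeta> s < x" "x < \<zeta> (s + 1)" using y by (auto simp: x_def)
    have "a \<le> \<zeta> s" "\<zeta> (s + 1) \<le> b" using breakpoint_bounds[of s] breakpoint_bounds[of "s + 1"] s1 by auto
    with x have "x \<in> {a..b}" by auto
    have "(\<Sum>k = 1..n. c k * trunc_power k x) = (\<Sum>k\<in>?I. c k * y ^ trunc_exp k)"
    proof (rule sum.mono_neutral_cong_right)
      show "\<forall>k\<in>{1..n} - ?I. c k * trunc_power k x = 0"
      proof
        fix k assume k: "k \<in> {1..n} - ?I"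
        show "c k * trunc_power k x = 0"
        proof (cases "\<zeta> s < \<xi> k")
          case True
          then have "x < \<xi> k" using next_knot[OF s1, of k] k x by auto
          then show ?thesis by (simp add: trunc_power_def)
        next
          case False
          then have "\<xi> k < \<xi> m" using k s by auto
          then have "k < m" using knots_mono[of m k] k m by force
          then show ?thesis using least k by simp
        qed
      qed
    qed (use x \<open>x \<in> {a..b}\<close> in \<open>auto simp: trunc_power_def x_def\<close>)
    then show ?thesis using zero[of x] by (simp add: q_def poly_sum poly_monom)
  qed
  then have "{0<..<\<zeta> (s + 1) - \<zeta> s} \<subseteq> {y. poly q y = 0}" by auto
  moreover have "infinite {0<..<\<zeta> (s + 1) - \<zeta> s}" using lt by (intro infinite_Ioo) simp
  ultimately have "infinite {y. poly q y = 0}" by (rule infinite_super)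
  then have "q = 0" using poly_roots_finite by blast
  then have "0 = coeff q (trunc_exp m)" by simp
  also have "\<dots> = (\<Sum>k\<in>?I. if k = m then c k else 0)"
    unfolding q_def coeff_sum using trunc_exp_inj[of _ m] m s by (intro sum.cong) auto
  also have "\<dots> = c m" using m s by simp
  finally show False using m by simp
qed

text \<open>The \<open>n\<close> auxiliary splines generate a space that contains all splines, and the \<open>n\<close> truncated
  powers are independent splines. Counting dimensions shows that the auxiliary splines form a
  basis; their own smoothness at the breakpoints is an outcome of this count.\<close>

theorem aux_spline_basis:
  "inj_on aux_spline {1..n}" "fun_space.independent (aux_spline ` {1..n})"
  "fun_space.span (aux_spline ` {1..n}) = spline_space a b p n \<xi>"
proof -
  have "inj_on trunc_power {1..n}" "fun_space.independent (trunc_power ` {1..n})"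
    using trunc_powers_independent by (blast intro!: independent_familyI[OF finite_atLeastAtMost])+
  moreover have "trunc_power ` {1..n} \<subseteq> spline_space a b p n \<xi>"
    using trunc_power_in_spline_space by auto
  ultimately show "inj_on aux_spline {1..n}" "fun_space.independent (aux_spline ` {1..n})"
    "fun_space.span (aux_spline ` {1..n}) = spline_space a b p n \<xi>"
    using basis_by_counting[of "{1..n}" "{1..n}", OF _ _ _ _ _ _ subspace_spline_space spline_space_subset_span]
    by simp_all
qed

end

section \<open>Cholesky factors\<close>

text \<open>One elimination step: the first column of the factor is the first column of the matrix divided
  by the square root of the pivot, and the Schur complement is again positive definite because its
  quadratic form at \<open>c\<close> is the form of the whole matrix at the vector that extends \<open>c\<close>
  by the minimizing first entry.\<close>

lemma cholesky_decomposition_exists: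
  fixes G :: "nat \<Rightarrow> nat \<Rightarrow> real"
  assumes sym: "\<And>i j. i < n \<Longrightarrow> j < n \<Longrightarrow> G i j = G j i"
    and pos: "\<And>c. (\<exists>i<n. c i \<noteq> 0) \<Longrightarrow> 0 < (\<Sum>i<n. \<Sum>j<n. c i * c j * G i j)"
  shows "\<exists>L. (\<forall>i<n. 0 < L i i) \<and> (\<forall>i j. i < j \<longrightarrow> L i j = 0) \<and>
    (\<forall>i<n. \<forall>j<n. G i j = (\<Sum>k<n. L i k * L j k))"
  using assms
proof (induction n arbitrary: G)
  case 0
  show ?case by (intro exI[of _ "\<lambda>_ _. 0"]) simp
next
  case (Suc n)
  define g where "g = G 0 0"
  define v where "v i = G (Suc i) 0" for i
  have G0: "G 0 (Suc i) = v i" if "i < n" for i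
    unfolding v_def using that by (intro Suc.prems(1)) auto
  have split: "(\<Sum>i<Suc n. \<Sum>j<Suc n. c i * c j * G i j) =
      c 0 * c 0 * g + 2 * c 0 * (\<Sum>i<n. c (Suc i) * v i)
      + (\<Sum>i<n. \<Sum>j<n. c (Suc i) * c (Suc j) * G (Suc i) (Suc j))" for c
  proof -
    have "(\<Sum>j<n. c 0 * c (Suc j) * G 0 (Suc j)) = c 0 * (\<Sum>i<n. c (Suc i) * v i)"
      unfolding sum_distrib_left by (intro sum.cong) (auto simp: G0)
    moreover have "(\<Sum>i<n. c (Suc i) * c 0 * G (Suc i) 0) = c 0 * (\<Sum>i<n. c (Suc i) * v i)"
      unfolding sum_distrib_left by (intro sum.cong) (auto simp: v_def)
    ultimately show ?thesis
      by (simp only: sum.lessThan_Suc_shift sum.distrib g_def)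
  qed
  have "0 < (\<Sum>i<Suc n. \<Sum>j<Suc n. (if i = 0 then 1 else 0) * (if j = 0 then 1 else 0) * G i j)"
    by (rule Suc.prems(2)) auto
  then have g: "0 < g" unfolding split by simp
  define H where "H i j = G (Suc i) (Suc j) - v i * v j / g" for i j
  have quad: "(\<Sum>i<n. \<Sum>j<n. d i * d j * H i j)
      = (\<Sum>i<n. \<Sum>j<n. d i * d j * G (Suc i) (Suc j)) - (\<Sum>i<n. d i * v i)\<^sup>2 / g" for d
  proof -
    have "(\<Sum>i<n. \<Sum>j<n. (d i * v i) * (d j * v j) / g) = (\<Sum>i<n. d i * v i)\<^sup>2 / g"
      by (simp add: power2_eq_square sum_product sum_divide_distrib)
    moreover have "d i * d j * H i j = d i * d j * G (Suc i) (Suc j) - (d i * v i) * (d j * v j) / g" for i j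
      by (simp add: H_def algebra_simps)
    ultimately show ?thesis by (simp add: sum_subtractf)
  qed
  have "\<exists>L. (\<forall>i<n. 0 < L i i) \<and> (\<forall>i j. i < j \<longrightarrow> L i j = 0) \<and> (\<forall>i<n. \<forall>j<n. H i j = (\<Sum>k<n. L i k * L j k))"
  proof (rule Suc.IH)
    show "H i j = H j i" if "i < n" "j < n" for i j
      using Suc.prems(1)[of "Suc i" "Suc j"] that by (simp add: H_def mult.commute)
    fix d :: "nat \<Rightarrow> real" assume d: "\<exists>i<n. d i \<noteq> 0"
    \<comment> \<open>The first entry \<open>- s / g\<close> minimizes the quadratic form of the whole matrix.\<close>
    define s where "s = (\<Sum>i<n. d i * v i)"
    define c where "c i = (case i of 0 \<Rightarrow> - s / g | Suc k \<Rightarrow> d k)" for i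
    from d obtain i where "i < n" "d i \<noteq> 0" by blast
    then have "Suc i < Suc n \<and> c (Suc i) \<noteq> 0" by (simp add: c_def)
    then have "\<exists>i<Suc n. c i \<noteq> 0" by blast
    from Suc.prems(2)[of c, OF this]
    have "0 < (- s / g) * (- s / g) * g + 2 * (- s / g) * s + (\<Sum>i<n. \<Sum>j<n. d i * d j * G (Suc i) (Suc j))"
      unfolding split by (simp add: c_def s_def)
    also have "(- s / g) * (- s / g) * g + 2 * (- s / g) * s = - (s\<^sup>2 / g)"
      using g by (simp add: power2_eq_square field_simps)
    finally show "0 < (\<Sum>i<n. \<Sum>j<n. d i * d j * H i j)" unfolding quad s_def by simp
  qed
  then obtain L where "(\<forall>i<n. 0 < L i i) \<and> (\<forall>i j. i < j \<longrightarrow> L i j = 0) \<and>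
    (\<forall>i<n. \<forall>j<n. H i j = (\<Sum>k<n. L i k * L j k))" ..
  then have L: "\<And>i. i < n \<Longrightarrow> 0 < L i i" "\<And>i j. i < j \<Longrightarrow> L i j = 0"
    "\<And>i j. i < n \<Longrightarrow> j < n \<Longrightarrow> H i j = (\<Sum>k<n. L i k * L j k)" by simp_all
  define K where "K i j = (case i of 0 \<Rightarrow> (case j of 0 \<Rightarrow> sqrt g | Suc _ \<Rightarrow> 0)
    | Suc i' \<Rightarrow> (case j of 0 \<Rightarrow> v i' / sqrt g | Suc j' \<Rightarrow> L i' j'))" for i j
  show ?case
  proof (intro exI[of _ K] conjI allI impI)
    fix i assume "i < Suc n"
    then show "0 < K i i" using g L(1) by (auto simp: K_def split: nat.split)
  next
    fix i j :: nat assume "i < j"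
    then show "K i j = 0" using L(2) by (auto simp: K_def split: nat.split)
  next
    fix i j assume ij: "i < Suc n" "j < Suc n"
    have gg: "sqrt g * sqrt g = g" using g by simp
    show "G i j = (\<Sum>k<Suc n. K i k * K j k)"
    proof (cases i)
      case 0
      then show ?thesis
        using g ij G0 by (cases j) (auto simp: K_def g_def[symmetric] sum.lessThan_Suc_shift gg simp del: sum.lessThan_Suc)
    next
      case i: (Suc i')
      show ?thesis
      proof (cases j)
        case 0
        then show ?thesis
          using g i ij by (auto simp: K_def v_def sum.lessThan_Suc_shift simp del: sum.lessThan_Suc)
      next
        case j: (Suc j')
        have "(\<Sum>k<Suc n. K i k * K j k) = v i' * v j' / g + H i' j'"
          using i j ij gg L(3) by (simp add: K_def sum.lessThan_Suc_shift del: sum.lessThan_Suc)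
        then show ?thesis using i j by (simp add: H_def)
      qed
    qed
  qed
qed

text \<open>The columns are determined from left to right: once the first \<open>j\<close> columns agree, the entry
  \<open>(j, j)\<close> of the product determines the square of a positive number, and the entries
  \<open>(i, j)\<close> then determine the rest of the next column.\<close>

lemma cholesky_decomposition_unique:
  fixes L K :: "nat \<Rightarrow> nat \<Rightarrow> real"
  assumes L: "\<And>i. i < n \<Longrightarrow> 0 < L i i" "\<And>i j. i < j \<Longrightarrow> j < n \<Longrightarrow> L i j = 0"
    and K: "\<And>i. i < n \<Longrightarrow> 0 < K i i" "\<And>i j. i < j \<Longrightarrow> j < n \<Longrightarrow> K i j = 0"
    and eq: "\<And>i j. i < n \<Longrightarrow> j < n \<Longrightarrow> (\<Sum>k<n. L i k * L j k) = (\<Sum>k<n. K i k * K j k)"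
    and ij: "i < n" "j < n"
  shows "L i j = K i j"
  using ij(2,1)
proof (induction j arbitrary: i rule: less_induct)
  case (less j)
  have expand: "(\<Sum>k<n. A i k * A j k) = (\<Sum>k<j. A i k * A j k) + A i j * A j j"
    if "\<And>i j. i < j \<Longrightarrow> j < n \<Longrightarrow> A i j = 0" for A :: "nat \<Rightarrow> nat \<Rightarrow> real" and i
  proof -
    have "(\<Sum>k<n. A i k * A j k) = (\<Sum>k<Suc j. A i k * A j k)"
      using that \<open>j < n\<close> by (intro sum.mono_neutral_right) auto
    then show ?thesis by simp
  qed
  have same: "(\<Sum>k<j. L i k * L j k) = (\<Sum>k<j. K i k * K j k)" if "i < n" for i
    using less that by (intro sum.cong) auto
  have cross: "L i j * L j j = K i j * K j j" if "i < n" for i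
    using eq[OF that \<open>j < n\<close>] expand[of L, OF L(2)] expand[of K, OF K(2)] same[OF that] by simp
  have "(L j j)\<^sup>2 = (K j j)\<^sup>2" using cross[OF \<open>j < n\<close>] by (simp add: power2_eq_square)
  then have "L j j = K j j" using L(1)[OF \<open>j < n\<close>] K(1)[OF \<open>j < n\<close>] by (simp add: power2_eq_iff_nonneg)
  then show ?case using cross[OF \<open>i < n\<close>] L(1)[OF \<open>j < n\<close>] by simp
qed

text \<open>As \<^const>\<open>cholesky\<close> is a definite description, both existence and uniqueness are
  needed before anything is known about it.\<close>

lemma is_cholesky_factor_cholesky:
  assumes G: "G \<in> carrier_mat n n"
    and sym: "\<And>i j. i < n \<Longrightarrow> j < n \<Longrightarrow> G $$ (i, j) = G $$ (j, i)"
    and pos: "\<And>c. (\<exists>i<n. c i \<noteq> 0) \<Longrightarrow> 0 < (\<Sum>i<n. \<Sum>j<n. c i * c j * G $$ (i, j))"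
  shows "is_cholesky_factor G (cholesky G)"
proof -
  have entry: "(Q * transpose_mat Q) $$ (i, j) = (\<Sum>k<n. Q $$ (i, k) * Q $$ (j, k))"
    if "Q \<in> carrier_mat n n" "i < n" "j < n" for Q :: "real mat" and i j
    using that by (auto simp: scalar_prod_def lessThan_atLeast0 intro!: sum.cong)
  have facts: "Q \<in> carrier_mat n n \<and> (\<forall>i<n. 0 < Q $$ (i, i)) \<and> (\<forall>i j. i < j \<longrightarrow> j < n \<longrightarrow> Q $$ (i, j) = 0) \<and>
      (\<forall>i<n. \<forall>j<n. G $$ (i, j) = (\<Sum>k<n. Q $$ (i, k) * Q $$ (j, k)))"
    if Q: "is_cholesky_factor G Q" for Q
  proof -
    have c: "Q \<in> carrier_mat n n" using Q G by (auto simp: is_cholesky_factor_def)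
    have "upper_triangular (transpose_mat Q)" using Q by (simp add: is_cholesky_factor_def)
    then have "Q $$ (i, j) = 0" if "i < j" "j < n" for i j
      using upper_triangularD[of "transpose_mat Q" i j] c that by simp
    moreover have "G $$ (i, j) = (\<Sum>k<n. Q $$ (i, k) * Q $$ (j, k))" if "i < n" "j < n" for i j
    proof -
      have "G = Q * transpose_mat Q" using Q by (simp add: is_cholesky_factor_def)
      then show ?thesis using entry[OF c that] by simp
    qed
    moreover have "\<forall>i<n. 0 < Q $$ (i, i)" using Q G by (auto simp: is_cholesky_factor_def)
    ultimately show ?thesis using c by blast
  qed
  obtain L where "(\<forall>i<n. 0 < L i i) \<and> (\<forall>i j. i < j \<longrightarrow> L i j = 0) \<and>
    (\<forall>i<n. \<forall>j<n. G $$ (i, j) = (\<Sum>k<n. L i k * L j k))"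
    using cholesky_decomposition_exists[of n "\<lambda>i j. G $$ (i, j)", OF sym pos] ..
  then have L: "\<And>i. i < n \<Longrightarrow> 0 < L i i" "\<And>i j. i < j \<Longrightarrow> L i j = 0"
    "\<And>i j. i < n \<Longrightarrow> j < n \<Longrightarrow> G $$ (i, j) = (\<Sum>k<n. L i k * L j k)" by simp_all
  define Q where "Q = Matrix.mat n n (\<lambda>(i, j). L i j)"
  have Qc: "Q \<in> carrier_mat n n" by (simp add: Q_def)
  have Q: "is_cholesky_factor G Q"
    unfolding is_cholesky_factor_def
  proof (intro conjI)
    show "G = Q * transpose_mat Q"
    proof (rule eq_matI)
      fix i j assume "i < dim_row (Q * transpose_mat Q)" "j < dim_col (Q * transpose_mat Q)"
      then have ij: "i < n" "j < n" by (simp_all add: Q_def)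
      show "G $$ (i, j) = (Q * transpose_mat Q) $$ (i, j)"
        unfolding entry[OF Qc ij] using L(3)[OF ij] ij by (simp add: Q_def)
    qed (use G Qc in auto)
  qed (use G L in \<open>auto simp: Q_def\<close>)
  moreover have "R = Q" if R: "is_cholesky_factor G R" for R
  proof (rule eq_matI)
    fix i j assume "i < dim_row Q" "j < dim_col Q"
    then have ij: "i < n" "j < n" using Qc by auto
    show "R $$ (i, j) = Q $$ (i, j)"
      by (rule cholesky_decomposition_unique[of n "\<lambda>i j. R $$ (i, j)" "\<lambda>i j. Q $$ (i, j)", OF _ _ _ _ _ ij])
        (use facts[OF R] facts[OF Q] in simp_all)
  qed (use facts[OF R] Qc in auto)
  ultimately show ?thesis unfolding cholesky_def by (rule theI)
qed

lemma cholesky_inverse: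
  assumes Q: "is_cholesky_factor G Q" and G: "G \<in> carrier_mat n n"
  shows "the (mat_inverse Q) \<in> carrier_mat n n"
    "the (mat_inverse Q) * Q = 1\<^sub>m n" "Q * the (mat_inverse Q) = 1\<^sub>m n"
proof -
  have c: "Q \<in> carrier_mat n n" using Q G by (auto simp: is_cholesky_factor_def)
  have "Determinant.det Q = prod_list (diag_mat Q)"
  proof (rule det_lower_triangular[OF _ c])
    fix i j assume ij: "i < j" "j < n"
    have "upper_triangular (transpose_mat Q)" using Q by (simp add: is_cholesky_factor_def)
    then show "Q $$ (i, j) = 0"
      using upper_triangularD[of "transpose_mat Q" i j] c ij by simp
  qed
  also have "\<dots> \<noteq> 0"
    using Q G c by (auto simp: prod_list_diag_prod is_cholesky_factor_def)
  finally have "Q \<in> Units (ring_mat TYPE(real) n ())" by (rule det_non_zero_imp_unit[OF c])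
  then obtain B where "mat_inverse Q = Some B" using mat_inverse(1)[OF c, of "()"] by (cases "mat_inverse Q") auto
  then show "the (mat_inverse Q) \<in> carrier_mat n n"
    "the (mat_inverse Q) * Q = 1\<^sub>m n" "Q * the (mat_inverse Q) = 1\<^sub>m n"
    using mat_inverse(2)[OF c] by auto
qed

section \<open>Orthonormal B-splines of a random variable\<close>

lemma borel_measurable_bspline_rec: "bspline_rec \<eta> i q \<in> borel_measurable borel"
proof (induction q arbitrary: i)
  case 0
  have "bspline_rec \<eta> i 0 = (\<lambda>x. if x \<in> {\<eta> i..<\<eta> (i + 1)} then 1 else 0)" by (auto simp: fun_eq_iff)
  then show ?case by simp
next
  case (Suc q)
  note [measurable] = Suc.IH[of i] Suc.IH[of "i + 1"]
  show ?case unfolding bspline_rec.simps(2)[abs_def] by measurable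
qed

lemma bspline_rec_bounded: "\<exists>C. \<forall>x\<in>{u..v}. \<bar>bspline_rec \<eta> i q x\<bar> \<le> C"
proof (induction q arbitrary: i)
  case 0
  show ?case by (intro exI[of _ 1]) auto
next
  case (Suc q)
  obtain C where C: "\<And>x. x \<in> {u..v} \<Longrightarrow> \<bar>bspline_rec \<eta> i q x\<bar> \<le> C" using Suc.IH by blast
  obtain D where D: "\<And>x. x \<in> {u..v} \<Longrightarrow> \<bar>bspline_rec \<eta> (i + 1) q x\<bar> \<le> D" using Suc.IH by blast
  define e where "e = \<eta> (i + Suc q + 1)"
  define K where "K = \<bar>u\<bar> + \<bar>v\<bar> + \<bar>\<eta> i\<bar> + \<bar>e\<bar>"
  define d where "d = \<bar>\<eta> (i + Suc q) - \<eta> i\<bar>"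
  define d' where "d' = \<bar>e - \<eta> (i + 1)\<bar>"
  show ?case
  proof (intro exI ballI)
    fix x assume x: "x \<in> {u..v}"
    have K: "\<bar>x - \<eta> i\<bar> \<le> K" "\<bar>e - x\<bar> \<le> K" using x by (auto simp: K_def)
    have "\<bar>bspline_rec \<eta> i (Suc q) x\<bar>
        \<le> \<bar>(x - \<eta> i) / (\<eta> (i + Suc q) - \<eta> i) * bspline_rec \<eta> i q x\<bar> + \<bar>(e - x) / (e - \<eta> (i + 1)) * bspline_rec \<eta> (i + 1) q x\<bar>"
      unfolding bspline_rec.simps(2) e_def by (rule abs_triangle_ineq)
    also have "\<dots> = \<bar>x - \<eta> i\<bar> / d * \<bar>bspline_rec \<eta> i q x\<bar> + \<bar>e - x\<bar> / d' * \<bar>bspline_rec \<eta> (i + 1) q x\<bar>"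
      by (simp add: abs_mult d_def d'_def)
    also have "\<dots> \<le> K / d * C + K / d' * D"
    proof -
      have "0 \<le> K" "0 \<le> d" "0 \<le> d'" by (simp_all add: K_def d_def d'_def)
      then show ?thesis
        using K C[OF x] D[OF x] by (intro add_mono mult_mono divide_right_mono) simp_all
    qed
    finally show "\<bar>bspline_rec \<eta> i (Suc q) x\<bar> \<le> K / d * C + K / d' * D" .
  qed
qed

context open_knot_sequence begin

lemma borel_measurable_aux_spline: "aux_spline i \<in> borel_measurable borel"
proof -
  note [measurable] = borel_measurable_bspline_rec[of \<xi> i p]
  have "bspline b \<xi> i p = (\<lambda>x. if x \<in> {b} then bspline b \<xi> i p b else bspline_rec \<xi> i p x)"
    by (auto simp: bspline_def)
  also have "\<dots> \<in> borel_measurable borel" by measurable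
  finally have [measurable]: "bspline b \<xi> i p \<in> borel_measurable borel" .
  show ?thesis unfolding aux_spline_def[abs_def] by measurable
qed

lemma aux_spline_bounded: "\<exists>C. \<forall>x. \<bar>aux_spline i x\<bar> \<le> C"
proof -
  obtain C where C: "\<And>x. x \<in> {a..b} \<Longrightarrow> \<bar>bspline_rec \<xi> i p x\<bar> \<le> C"
    using bspline_rec_bounded by blast
  have "\<bar>aux_spline i x\<bar> \<le> 1 + \<bar>C\<bar> + \<bar>bspline b \<xi> i p b\<bar>" for x
  proof (cases "x \<in> {a..b} \<and> x \<noteq> b")
    case True
    then have "\<bar>bspline b \<xi> i p x\<bar> \<le> C" using C[of x] by (simp add: bspline_eq_rec)
    then have "\<bar>aux_spline i x\<bar> \<le> max 1 C" using True by (simp add: aux_spline_def le_max_iff_disj)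
    then show ?thesis by linarith
  next
    case False
    then have "\<bar>aux_spline i x\<bar> \<le> max 1 \<bar>bspline b \<xi> i p b\<bar>" by (auto simp: aux_spline_def)
    then show ?thesis by linarith
  qed
  then show ?thesis by blast
qed

lemma aux_vec_index: "i < n \<Longrightarrow> x \<in> {a..b} \<Longrightarrow> vec_index (aux_vec b p n \<xi> x) i = aux_spline (Suc i) x"
  by (simp add: aux_vec_def aux_spline_def)

end

locale spline_random_variable = open_knot_sequence a b p n \<xi> + prob_space M
  for a b p n \<xi> and M :: "'w measure" +
  fixes Y :: "'w \<Rightarrow> real" and f :: "real \<Rightarrow> real"
  assumes density_nonneg: "\<And>x. 0 \<le> f x"
    and distributed_density: "distributed M lborel Y (\<lambda>x. ennreal (f x))"
    and density_continuous: "continuous_on {a..b} f"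
    and density_support: "closure {x. 0 < f x} = {a..b}"
    and range_Y: "\<And>\<omega>. \<omega> \<in> space M \<Longrightarrow> Y \<omega> \<in> {a..b}"
begin

lemma borel_measurable_Y: "Y \<in> borel_measurable M"
  using distributed_measurable[OF distributed_density] by simp

lemma integrable_aux_spline: "integrable M (\<lambda>\<omega>. aux_spline i (Y \<omega>) * aux_spline j (Y \<omega>))"
proof -
  note [measurable] = borel_measurable_Y borel_measurable_aux_spline
  obtain C D where CD: "\<And>x. \<bar>aux_spline i x\<bar> \<le> C" "\<And>x. \<bar>aux_spline j x\<bar> \<le> D"
    using aux_spline_bounded by meson
  have "\<bar>aux_spline i x * aux_spline j x\<bar> \<le> C * D" for x
    unfolding abs_mult using CD[of x] by (intro mult_mono) auto
  then show ?thesis by (intro integrable_const_bound[of _ "C * D"]) auto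
qed

text \<open>A nonempty open subset of the support meets the set where the density is positive, and by
  continuity the density is then positive on a whole ball, which has positive Lebesgue measure.\<close>

lemma density_charges_open_sets:
  assumes U: "open U" "U \<noteq> {}" "U \<subseteq> {a..b}" and null: "AE x in lborel. 0 < f x \<longrightarrow> x \<notin> U"
  shows False
proof -
  obtain c where c: "c \<in> U" using U(2) by blast
  then have "c \<in> closure {x. 0 < f x}" using U(3) density_support by blast
  then obtain y where y: "y \<in> U" "0 < f y"
    using U(1) c unfolding closure_iff_nhds_not_empty by (metis (mono_tags, lifting) disjoint_iff mem_Collect_eq order_refl)
  let ?V = "U \<inter> f -` {0<..}"
  have "continuous_on U f" using density_continuous U(3) by (rule continuous_on_subset)
  then have "open ?V" using U(1) by (intro continuous_open_preimage) auto
  moreover have "y \<in> ?V" using y by simp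
  ultimately obtain e where e: "0 < e" "ball y e \<subseteq> ?V" using openE by blast
  have "AE x in lborel. x \<notin> ball y e" using null by eventually_elim (use e(2) in auto)
  then have "ball y e \<in> null_sets lborel" by (subst AE_iff_null_sets) auto
  then have "emeasure lborel (ball y e) = 0" by auto
  moreover have "ball y e = {y - e<..<y + e}" by (rule ball_eq_greaterThanLessThan)
  ultimately show False using e(1) by simp
qed

text \<open>A spline that vanishes almost surely at the random variable is zero: on each knot interval it is
  a polynomial with finitely many roots unless it is zero, while the density charges every open
  part of the interval.\<close>

lemma spline_zero_if_AE_zero:
  assumes s: "s \<in> spline_space a b p n \<xi>" "s \<in> borel_measurable borel" and AE: "AE \<omega> in M. s (Y \<omega>) = 0"
  shows "s x = 0"
proof -
  note [measurable] = s(2)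
  obtain h where h: "spline_pieces s h" and outside: "\<And>x. x \<notin> {a..b} \<Longrightarrow> s x = 0"
    using s(1) by (auto simp: spline_space_iff)
  have "AE x in distr M lborel Y. s x = 0"
    using AE borel_measurable_Y by (subst AE_distr_iff) auto
  then have "AE x in density lborel (\<lambda>x. ennreal (f x)). s x = 0"
    unfolding distributed_distr_eq_density[OF distributed_density] .
  then have zero: "AE x in lborel. 0 < f x \<longrightarrow> s x = 0"
    using distributed_borel_measurable[OF distributed_density] by (subst (asm) AE_density) auto
  have hz: "h j = 0" if j: "j \<in> {1..r - 1}" for j
  proof (rule ccontr)
    assume "h j \<noteq> 0"
    then have fin: "finite {x. poly (h j) x = 0}" by (rule poly_roots_finite)
    let ?U = "{\<zeta> j<..<\<zeta> (j + 1)}"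
    have jr: "j \<in> {1..r}" "j + 1 \<in> {1..r}" using j by auto
    have piece: "\<forall>x\<in>{\<zeta> j..<\<zeta> (j + 1)}. s x = poly (h j) x" using h j by (simp add: spline_pieces_def)
    have "AE x in lborel. x \<notin> {x. poly (h j) x = 0}"
      using fin by (intro AE_not_in countable_imp_null_set_lborel countable_finite)
    with zero have "AE x in lborel. 0 < f x \<longrightarrow> x \<notin> ?U"
      by eventually_elim (use piece in auto)
    moreover have "?U \<noteq> {}" using breakpoint_less[of j "j + 1"] jr by auto
    moreover have "?U \<subseteq> {a..b}" using breakpoint_bounds[OF jr(1)] breakpoint_bounds[OF jr(2)] by auto
    ultimately show False using density_charges_open_sets[of ?U] by simp
  qed
  consider "x \<notin> {a..b}" | "x = b" | "a \<le> x" "x < b" by force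
  then show "s x = 0"
  proof cases
    case 2
    have "s b = poly (h (r - 1)) b" using h by (simp add: spline_pieces_def)
    then show ?thesis using 2 hz[of "r - 1"] num_breaks_ge_2 by simp
  next
    case 3
    then obtain j where j: "j \<in> {1..r - 1}" "\<zeta> j \<le> x" "x < \<zeta> (j + 1)" by (rule breakpoint_interval)
    then have "s x = poly (h j) x" using h unfolding spline_pieces_def by auto
    then show ?thesis using hz[OF j(1)] by simp
  qed (rule outside)
qed

abbreviation (input) "G \<equiv> moment_mat M Y b p n \<xi>"
abbreviation (input) "Q \<equiv> cholesky G"
abbreviation (input) "R \<equiv> the (mat_inverse Q)"

lemma moment_mat_carrier: "G \<in> carrier_mat n n"
  by (simp add: moment_mat_def)

lemma moment_mat_index:
  "i < n \<Longrightarrow> j < n \<Longrightarrow> G $$ (i, j) = expectation (\<lambda>\<omega>. aux_spline (Suc i) (Y \<omega>) * aux_spline (Suc j) (Y \<omega>))"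
  using range_Y by (simp add: moment_mat_def aux_vec_index cong: Bochner_Integration.integral_cong)

lemma integrable_bilinear:
  "integrable M (\<lambda>\<omega>. (\<Sum>i<n. c i * aux_spline (Suc i) (Y \<omega>)) * (\<Sum>j<n. d j * aux_spline (Suc j) (Y \<omega>)))"
proof -
  have "integrable M (\<lambda>\<omega>. \<Sum>i<n. \<Sum>j<n. c i * d j * (aux_spline (Suc i) (Y \<omega>) * aux_spline (Suc j) (Y \<omega>)))"
    by (intro Bochner_Integration.integrable_sum integrable_mult_right integrable_aux_spline)
  then show ?thesis by (simp add: sum_product mult_ac)
qed

lemma expectation_bilinear:
  "expectation (\<lambda>\<omega>. (\<Sum>i<n. c i * aux_spline (Suc i) (Y \<omega>)) * (\<Sum>j<n. d j * aux_spline (Suc j) (Y \<omega>)))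
    = (\<Sum>i<n. \<Sum>j<n. c i * d j * G $$ (i, j))"
proof -
  have "expectation (\<lambda>\<omega>. (\<Sum>i<n. c i * aux_spline (Suc i) (Y \<omega>)) * (\<Sum>j<n. d j * aux_spline (Suc j) (Y \<omega>)))
      = expectation (\<lambda>\<omega>. \<Sum>i<n. \<Sum>j<n. c i * d j * (aux_spline (Suc i) (Y \<omega>) * aux_spline (Suc j) (Y \<omega>)))"
    by (simp add: sum_product mult_ac)
  also have "\<dots> = (\<Sum>i<n. \<Sum>j<n. c i * d j * expectation (\<lambda>\<omega>. aux_spline (Suc i) (Y \<omega>) * aux_spline (Suc j) (Y \<omega>)))"
    using integrable_aux_spline by (simp add: Bochner_Integration.integral_sum)
  finally show ?thesis by (simp add: moment_mat_index)
qed

text \<open>The quadratic form at \<open>c\<close> is the second moment of the spline with coefficients \<open>c\<close>. If it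
  is zero, this spline is zero almost surely and hence identically, which contradicts the
  independence of the auxiliary splines.\<close>

lemma moment_mat_positive:
  assumes "\<exists>i<n. c i \<noteq> 0"
  shows "0 < (\<Sum>i<n. \<Sum>j<n. c i * c j * G $$ (i, j))"
proof -
  define s where "s x = (\<Sum>i<n. c i * aux_spline (Suc i) x)" for x
  have meas: "s \<in> borel_measurable borel"
    unfolding s_def[abs_def] using borel_measurable_aux_spline by measurable
  have s_eq: "s x = (\<Sum>i = 1..n. c (i - 1) * aux_spline i x)" for x
    by (simp add: s_def sum.atLeast1_atMost_eq)
  then have "s = (\<Sum>i = 1..n. fscale (c (i - 1)) (aux_spline i))" by (simp add: fun_eq_iff sum_fscale_apply)
  then have "s \<in> fun_space.span (aux_spline ` {1..n})"
    by (auto intro!: fun_space.span_sum fun_space.span_scale intro: fun_space.span_base)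
  then have spline: "s \<in> spline_space a b p n \<xi>" using aux_spline_basis(3) by simp
  have quad: "(\<Sum>i<n. \<Sum>j<n. c i * c j * G $$ (i, j)) = expectation (\<lambda>\<omega>. s (Y \<omega>) * s (Y \<omega>))"
    unfolding s_def by (rule expectation_bilinear[symmetric])
  have int: "integrable M (\<lambda>\<omega>. s (Y \<omega>) * s (Y \<omega>))"
    unfolding s_def by (rule integrable_bilinear)
  have "expectation (\<lambda>\<omega>. s (Y \<omega>) * s (Y \<omega>)) \<noteq> 0"
  proof
    assume "expectation (\<lambda>\<omega>. s (Y \<omega>) * s (Y \<omega>)) = 0"
    then have "AE \<omega> in M. s (Y \<omega>) = 0"
      using integral_nonneg_eq_0_iff_AE[OF int] by simp
    then have "s x = 0" for x by (rule spline_zero_if_AE_zero[OF spline meas])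
    then have "(\<Sum>i = 1..n. c (i - 1) * aux_spline i x) = 0" for x using s_eq by metis
    note zero = independent_familyD[OF finite_atLeastAtMost aux_spline_basis(1,2) this]
    obtain i where "i < n" "c i \<noteq> 0" using assms by blast
    with zero[of "Suc i"] show False by simp
  qed
  moreover have "0 \<le> expectation (\<lambda>\<omega>. s (Y \<omega>) * s (Y \<omega>))" by (intro Bochner_Integration.integral_nonneg) simp
  ultimately show ?thesis unfolding quad by linarith
qed

lemma cholesky_moment_mat: "is_cholesky_factor G Q"
  by (rule is_cholesky_factor_cholesky[OF moment_mat_carrier _ moment_mat_positive])
    (simp_all add: moment_mat_index mult.commute)

lemmas moment_inverse = cholesky_inverse[OF cholesky_moment_mat moment_mat_carrier]

lemma factor_carrier: "Q \<in> carrier_mat n n"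
  using cholesky_moment_mat moment_mat_carrier by (auto simp: is_cholesky_factor_def)

lemma factor_times_inverse:
  "i < n \<Longrightarrow> j < n \<Longrightarrow> (\<Sum>k<n. Q $$ (i, k) * R $$ (k, j)) = (if i = j then 1 else 0)"
  "i < n \<Longrightarrow> j < n \<Longrightarrow> (\<Sum>k<n. R $$ (i, k) * Q $$ (k, j)) = (if i = j then 1 else 0)"
proof -
  have entry: "(A * B) $$ (i, j) = (\<Sum>k<n. A $$ (i, k) * B $$ (k, j))"
    if "A \<in> carrier_mat n n" "B \<in> carrier_mat n n" "i < n" "j < n" for A B :: "real mat"
    using that by (auto simp: scalar_prod_def lessThan_atLeast0 intro!: sum.cong)
  assume ij: "i < n" "j < n"
  show "(\<Sum>k<n. Q $$ (i, k) * R $$ (k, j)) = (if i = j then 1 else 0)"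
    using entry[OF factor_carrier moment_inverse(1) ij] moment_inverse(3) ij by simp
  show "(\<Sum>k<n. R $$ (i, k) * Q $$ (k, j)) = (if i = j then 1 else 0)"
    using entry[OF moment_inverse(1) factor_carrier ij] moment_inverse(2) ij by simp
qed

abbreviation (input) "\<psi> \<equiv> orth_bspline M Y a b p n \<xi>"

lemma orth_bspline_expand:
  assumes "i < n"
  shows "\<psi> (Suc i) x = (\<Sum>j<n. R $$ (i, j) * aux_spline (Suc j) x)"
proof (cases "x \<in> {a..b}")
  case True
  have "\<psi> (Suc i) x = Matrix.row R i \<bullet> aux_vec b p n \<xi> x"
    using True assms moment_inverse(1) by (simp add: orth_bspline_def)
  also have "\<dots> = (\<Sum>j<n. R $$ (i, j) * vec_index (aux_vec b p n \<xi> x) j)"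
    using assms moment_inverse(1) by (simp add: scalar_prod_def aux_vec_def lessThan_atLeast0)
  also have "\<dots> = (\<Sum>j<n. R $$ (i, j) * aux_spline (Suc j) x)"
    using True by (simp add: aux_vec_index)
  finally show ?thesis .
next
  case False
  then have "aux_spline j x = 0" for j by (simp only: aux_spline_def if_False)
  then show ?thesis using False by (simp only: orth_bspline_def if_False) simp
qed

lemma aux_spline_expand:
  assumes "i < n"
  shows "aux_spline (Suc i) x = (\<Sum>j<n. Q $$ (i, j) * \<psi> (Suc j) x)"
proof -
  have "(\<Sum>j<n. Q $$ (i, j) * \<psi> (Suc j) x)
      = (\<Sum>j<n. \<Sum>k<n. Q $$ (i, j) * R $$ (j, k) * aux_spline (Suc k) x)"
    by (simp add: orth_bspline_expand sum_distrib_left mult.assoc)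
  also have "\<dots> = (\<Sum>k<n. (\<Sum>j<n. Q $$ (i, j) * R $$ (j, k)) * aux_spline (Suc k) x)"
    by (subst sum.swap) (simp add: sum_distrib_right)
  also have "\<dots> = (\<Sum>k<n. if i = k then aux_spline (Suc k) x else 0)"
    using assms by (intro sum.cong) (auto simp: factor_times_inverse)
  also have "\<dots> = aux_spline (Suc i) x" using assms by simp
  finally show ?thesis by simp
qed

text \<open>The orthonormal B-splines arise from the auxiliary splines by an invertible matrix.\<close>

lemma span_orth_bspline: "fun_space.span (\<psi> ` {1..n}) = spline_space a b p n \<xi>"
proof -
  have in_span: "t i \<in> fun_space.span (u ` {1..n})"
    if i: "i \<in> {1..n}" and expand: "\<And>i x. i < n \<Longrightarrow> t (Suc i) x = (\<Sum>j<n. A $$ (i, j) * u (Suc j) x)"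
    for t u :: "nat \<Rightarrow> real \<Rightarrow> real" and A i
  proof -
    have "t i x = (\<Sum>j = 1..n. A $$ (i - 1, j - 1) * u j x)" for x
    proof -
      have "Suc (i - 1) = i" "i - 1 < n" using i by auto
      then show ?thesis using expand[of "i - 1" x] by (simp add: sum.atLeast1_atMost_eq)
    qed
    then have "t i = (\<Sum>j = 1..n. fscale (A $$ (i - 1, j - 1)) (u j))" by (simp add: fun_eq_iff sum_fscale_apply)
    then show ?thesis
      unfolding span_family_iff[OF finite_atLeastAtMost] by (rule exI[of _ "\<lambda>j. A $$ (i - 1, j - 1)"])
  qed
  have "\<psi> ` {1..n} \<subseteq> fun_space.span (aux_spline ` {1..n})"
    using in_span[of _ \<psi> R aux_spline] orth_bspline_expand by blast
  moreover have "aux_spline ` {1..n} \<subseteq> fun_space.span (\<psi> ` {1..n})"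
    using in_span[of _ aux_spline Q \<psi>] aux_spline_expand by blast
  ultimately have "fun_space.span (\<psi> ` {1..n}) = fun_space.span (aux_spline ` {1..n})"
    by (metis fun_space.span_eq)
  then show ?thesis using aux_spline_basis(3) by simp
qed

lemma borel_measurable_orth_bspline:
  assumes "i \<in> {1..n}"
  shows "\<psi> i \<in> borel_measurable borel"
proof -
  note [measurable] = borel_measurable_aux_spline
  have "\<psi> i = (\<lambda>x. \<Sum>j<n. R $$ (i - 1, j) * aux_spline (Suc j) x)"
    using orth_bspline_expand[of "i - 1"] assms by (auto simp: fun_eq_iff)
  also have "\<dots> \<in> borel_measurable borel" by measurable
  finally show ?thesis .
qed

lemma integrable_orth_bspline:
  assumes "i \<in> {1..n}" "j \<in> {1..n}"
  shows "integrable M (\<lambda>\<omega>. \<psi> i (Y \<omega>) * \<psi> j (Y \<omega>))"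
proof -
  have "integrable M (\<lambda>\<omega>. \<psi> (Suc i) (Y \<omega>) * \<psi> (Suc j) (Y \<omega>))" if "i < n" "j < n" for i j
    unfolding orth_bspline_expand[OF that(1)] orth_bspline_expand[OF that(2)]
    by (rule integrable_bilinear)
  from this[of "i - 1" "j - 1"] assms show ?thesis by auto
qed

text \<open>With \<open>R = Q\<inverse>\<close> the Gram matrix of the new family is
  \<open>R G R\<^sup>T = (R Q) (R Q)\<^sup>T = 1\<close>.\<close>

lemma orth_bspline_orthonormal:
  assumes "i \<in> {1..n}" "j \<in> {1..n}"
  shows "expectation (\<lambda>\<omega>. \<psi> i (Y \<omega>) * \<psi> j (Y \<omega>)) = (if i = j then 1 else 0)"
proof -
  have "expectation (\<lambda>\<omega>. \<psi> (Suc i) (Y \<omega>) * \<psi> (Suc j) (Y \<omega>)) = (if i = j then 1 else 0)"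
    if ij: "i < n" "j < n" for i j
  proof -
    have G: "G $$ (k, l) = (\<Sum>m<n. Q $$ (k, m) * Q $$ (l, m))" if "k < n" "l < n" for k l
    proof -
      have "G = Q * transpose_mat Q" using cholesky_moment_mat by (simp add: is_cholesky_factor_def)
      then have "G $$ (k, l) = (Q * transpose_mat Q) $$ (k, l)" by (rule arg_cong)
      also have "\<dots> = (\<Sum>m<n. Q $$ (k, m) * Q $$ (l, m))"
        using that factor_carrier by (auto simp: scalar_prod_def lessThan_atLeast0 intro!: sum.cong)
      finally show ?thesis .
    qed
    have "expectation (\<lambda>\<omega>. \<psi> (Suc i) (Y \<omega>) * \<psi> (Suc j) (Y \<omega>)) = (\<Sum>k<n. \<Sum>l<n. R $$ (i, k) * R $$ (j, l) * G $$ (k, l))"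
      unfolding orth_bspline_expand[OF ij(1)] orth_bspline_expand[OF ij(2)] by (rule expectation_bilinear)
    also have "\<dots> = (\<Sum>k<n. \<Sum>l<n. \<Sum>m<n. (R $$ (i, k) * Q $$ (k, m)) * (R $$ (j, l) * Q $$ (l, m)))"
      by (simp add: G sum_distrib_left mult_ac)
    also have "\<dots> = (\<Sum>k<n. \<Sum>m<n. \<Sum>l<n. (R $$ (i, k) * Q $$ (k, m)) * (R $$ (j, l) * Q $$ (l, m)))"
      by (intro sum.cong refl sum.swap)
    also have "\<dots> = (\<Sum>m<n. \<Sum>k<n. \<Sum>l<n. (R $$ (i, k) * Q $$ (k, m)) * (R $$ (j, l) * Q $$ (l, m)))"
      by (rule sum.swap)
    also have "\<dots> = (\<Sum>m<n. (\<Sum>k<n. R $$ (i, k) * Q $$ (k, m)) * (\<Sum>l<n. R $$ (j, l) * Q $$ (l, m)))"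
      by (simp only: sum_product)
    also have "\<dots> = (\<Sum>m<n. if m = i then (if i = j then 1 else 0) else 0)"
      using ij by (intro sum.cong) (auto simp: factor_times_inverse)
    also have "\<dots> = (if i = j then 1 else 0)" using ij by simp
    finally show ?thesis .
  qed
  from this[of "i - 1" "j - 1"] assms show ?thesis by auto
qed

end

section \<open>Tensor products of orthonormal families\<close>

text \<open>A product of linear combinations expands into a linear combination of products.\<close>

lemma tensor_product_span:
  fixes t :: "'n::finite \<Rightarrow> 'i \<Rightarrow> real \<Rightarrow> real"
  assumes fin: "\<And>k. finite (I k)"
  shows "tensor_product (\<lambda>k. fun_space.span (t k ` I k)) =
    fun_space.span ((\<lambda>i x. \<Prod>k\<in>UNIV. t k (i k) (x $ k)) ` {i. \<forall>k. i k \<in> I k})"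
proof
  let ?J = "{i. \<forall>k. i k \<in> I k}"
  let ?T = "\<lambda>i x. \<Prod>k\<in>UNIV. t k (i k) (x $ k)"
  have J: "?J = PiE UNIV I" by (auto simp: PiE_UNIV_domain)
  then have finJ: "finite ?J" using fin by (simp add: finite_PiE)
  show "tensor_product (\<lambda>k. fun_space.span (t k ` I k)) \<subseteq> fun_space.span (?T ` ?J)"
    unfolding tensor_product_def
  proof (rule fun_space.span_minimal[OF _ fun_space.subspace_span], safe)
    fix g :: "'n \<Rightarrow> real \<Rightarrow> real" assume "\<forall>k. g k \<in> fun_space.span (t k ` I k)"
    then have "\<forall>k. \<exists>c. g k = (\<Sum>i\<in>I k. fscale (c i) (t k i))"
      using span_family_iff[OF fin] by blast
    then obtain c where c: "\<And>k. g k = (\<Sum>i\<in>I k. fscale (c k i) (t k i))" by metis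
    have "(\<Prod>k\<in>UNIV. g k (x $ k)) = (\<Sum>i\<in>?J. (\<Prod>k\<in>UNIV. c k (i k)) * ?T i x)" for x :: "real ^ 'n"
      unfolding J by (simp add: c sum_fscale_apply prod_sum_PiE fin prod.distrib)
    then have "(\<lambda>x. \<Prod>k\<in>UNIV. g k (x $ k)) = (\<Sum>i\<in>?J. fscale (\<Prod>k\<in>UNIV. c k (i k)) (?T i))"
      by (simp add: fun_eq_iff sum_fscale_apply)
    then show "(\<lambda>x. \<Prod>k\<in>UNIV. g k (x $ k)) \<in> fun_space.span (?T ` ?J)"
      unfolding span_family_iff[OF finJ] by (rule exI[of _ "\<lambda>i. \<Prod>k\<in>UNIV. c k (i k)"])
  qed
  show "fun_space.span (?T ` ?J) \<subseteq> tensor_product (\<lambda>k. fun_space.span (t k ` I k))"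
    unfolding tensor_product_def
  proof (rule fun_space.span_mono, safe)
    fix i assume "\<forall>k. i k \<in> I k"
    then show "\<exists>g. ?T i = (\<lambda>x. \<Prod>k\<in>UNIV. g k (x $ k)) \<and> (\<forall>k. g k \<in> fun_space.span (t k ` I k))"
      by (intro exI[of _ "\<lambda>k. t k (i k)"]) (auto intro: fun_space.span_base)
  qed
qed

text \<open>Independence of the coordinates turns the inner product of two products of functions into the
  product of the univariate inner products.\<close>

lemma (in prob_space) orthonormal_products:
  fixes X :: "'a \<Rightarrow> real ^ 'n::finite" and t :: "'n \<Rightarrow> 'i \<Rightarrow> real \<Rightarrow> real"
  assumes indep: "indep_vars (\<lambda>_. borel) (\<lambda>k \<omega>. X \<omega> $ k) UNIV"
    and meas: "\<And>k i. i \<in> I k \<Longrightarrow> t k i \<in> borel_measurable borel"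
    and int: "\<And>k i j. i \<in> I k \<Longrightarrow> j \<in> I k \<Longrightarrow> integrable M (\<lambda>\<omega>. t k i (X \<omega> $ k) * t k j (X \<omega> $ k))"
    and ortho: "\<And>k i j. i \<in> I k \<Longrightarrow> j \<in> I k \<Longrightarrow>
      expectation (\<lambda>\<omega>. t k i (X \<omega> $ k) * t k j (X \<omega> $ k)) = (if i = j then 1 else 0)"
    and ij: "\<And>k. i k \<in> I k" "\<And>k. j k \<in> I k"
  defines "T \<equiv> \<lambda>i x. \<Prod>k\<in>UNIV. t k (i k) (x $ k)"
  shows "integrable M (\<lambda>\<omega>. T i (X \<omega>) * T j (X \<omega>))"
    and "expectation (\<lambda>\<omega>. T i (X \<omega>) * T j (X \<omega>)) = (if i = j then 1 else 0)"
proof -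
  have prod: "T i (X \<omega>) * T j (X \<omega>) = (\<Prod>k\<in>UNIV. t k (i k) (X \<omega> $ k) * t k (j k) (X \<omega> $ k))" for \<omega>
    by (simp add: T_def prod.distrib)
  have ind: "indep_vars (\<lambda>_. borel) (\<lambda>k \<omega>. t k (i k) (X \<omega> $ k) * t k (j k) (X \<omega> $ k)) UNIV"
  proof (rule indep_vars_compose2[OF indep])
    fix k
    have [measurable]: "t k (i k) \<in> borel_measurable borel" "t k (j k) \<in> borel_measurable borel"
      using meas ij by auto
    show "(\<lambda>x. t k (i k) x * t k (j k) x) \<in> borel_measurable borel" by measurable
  qed
  show "integrable M (\<lambda>\<omega>. T i (X \<omega>) * T j (X \<omega>))"
    unfolding prod using int ij by (intro indep_vars_integrable[OF _ ind]) auto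
  have "expectation (\<lambda>\<omega>. T i (X \<omega>) * T j (X \<omega>)) = (\<Prod>k\<in>UNIV. expectation (\<lambda>\<omega>. t k (i k) (X \<omega> $ k) * t k (j k) (X \<omega> $ k)))"
    unfolding prod using int ij by (intro indep_vars_lebesgue_integral[OF _ ind]) auto
  also have "\<dots> = (\<Prod>k\<in>UNIV. if i k = j k then 1 else 0)" using ortho ij by simp
  also have "\<dots> = (if i = j then 1 else 0)"
  proof (cases "i = j")
    case False
    then obtain k where "i k \<noteq> j k" by blast
    then have "(\<Prod>k\<in>UNIV. if i k = j k then 1 else 0 :: real) = 0" by (intro prod_zero) auto
    then show ?thesis using False by simp
  qed simp
  finally show "expectation (\<lambda>\<omega>. T i (X \<omega>) * T j (X \<omega>)) = (if i = j then 1 else 0)" .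
qed

text \<open>Multiply a vanishing combination by one member and take expectations.\<close>

lemma (in prob_space) orthonormal_independent:
  fixes T :: "'i \<Rightarrow> 'b \<Rightarrow> real"
  assumes fin: "finite J"
    and int: "\<And>i j. i \<in> J \<Longrightarrow> j \<in> J \<Longrightarrow> integrable M (\<lambda>\<omega>. T i (X \<omega>) * T j (X \<omega>))"
    and ortho: "\<And>i j. i \<in> J \<Longrightarrow> j \<in> J \<Longrightarrow> expectation (\<lambda>\<omega>. T i (X \<omega>) * T j (X \<omega>)) = (if i = j then 1 else 0)"
  shows "inj_on T J" "fun_space.independent (T ` J)"
proof -
  have zero: "c j = 0" if sum: "\<And>x. (\<Sum>i\<in>J. c i * T i x) = 0" and j: "j \<in> J" for c j
  proof -
    have "0 = expectation (\<lambda>\<omega>. (\<Sum>i\<in>J. c i * T i (X \<omega>)) * T j (X \<omega>))" by (simp add: sum)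
    also have "\<dots> = expectation (\<lambda>\<omega>. \<Sum>i\<in>J. c i * (T i (X \<omega>) * T j (X \<omega>)))"
      by (simp add: sum_distrib_right mult.assoc)
    also have "\<dots> = (\<Sum>i\<in>J. c i * expectation (\<lambda>\<omega>. T i (X \<omega>) * T j (X \<omega>)))"
      using int j by (simp add: Bochner_Integration.integral_sum)
    also have "\<dots> = (\<Sum>i\<in>J. if i = j then c i else 0)"
      using ortho j by (intro sum.cong) auto
    also have "\<dots> = c j" using fin j by simp
    finally show ?thesis by simp
  qed
  show "inj_on T J" by (rule independent_familyI(1)[OF fin]) (rule zero)
  show "fun_space.independent (T ` J)" by (rule independent_familyI(2)[OF fin]) (rule zero)
qed

theorem proposition5p4:
  fixes M :: "'w measure"
    and X :: "'w \<Rightarrow> real ^ 'n::finite"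
    and a b :: "real ^ 'n"
    and f :: "'n \<Rightarrow> real \<Rightarrow> real"
    and p n :: "'n \<Rightarrow> nat"
    and \<xi> :: "'n \<Rightarrow> nat \<Rightarrow> real"
  assumes "prob_space M"
    and "\<forall>k. a $ k < b $ k"
    and "X \<in> measurable M (restrict_space borel (cbox a b))"
    and "prob_space.indep_vars M (\<lambda>_. borel) (\<lambda>k \<omega>. X \<omega> $ k) UNIV"
    and "\<forall>k x. 0 \<le> f k x"
    and "\<forall>k. distributed M lborel (\<lambda>\<omega>. X \<omega> $ k) (\<lambda>x. ennreal (f k x))"
    and "\<forall>k. continuous_on {a $ k..b $ k} (f k)"
    and "\<forall>k. closure {x. f k x > 0} = {a $ k..b $ k}"
    and "\<forall>k. p k < n k"
    and "\<forall>k. open_knots (a $ k) (b $ k) (p k) (n k) (\<xi> k)"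
  shows "inj_on (multi_orth_bspline M X a b p n \<xi>) (multi_indices n) \<and>
    fun_space.independent (multi_orth_bspline M X a b p n \<xi> ` multi_indices n) \<and>
    tensor_product (\<lambda>k. spline_space (a $ k) (b $ k) (p k) (n k) (\<xi> k)) =
      fun_space.span (multi_orth_bspline M X a b p n \<xi> ` multi_indices n) \<and>
    fun_space.span (multi_orth_bspline M X a b p n \<xi> ` multi_indices n) =
      tensor_product (\<lambda>k. fun_space.span
        (orth_bspline M (\<lambda>\<omega>. X \<omega> $ k) (a $ k) (b $ k) (p k) (n k) (\<xi> k) ` {1..n k})) \<and>
    card (multi_indices n) = (\<Prod>k\<in>UNIV. n k)"
proof -
  interpret prob_space M by fact
  have range: "X \<omega> $ k \<in> {a $ k..b $ k}" if "\<omega> \<in> space M" for \<omega> k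
  proof -
    have "X \<omega> \<in> cbox a b"
      using measurable_space[OF assms(3) that] by (simp add: space_restrict_space)
    then show ?thesis by (simp add: mem_box_cart)
  qed
  have coordinate: "spline_random_variable (a $ k) (b $ k) (p k) (n k) (\<xi> k) M (\<lambda>\<omega>. X \<omega> $ k) (f k)" for k
    using assms range by unfold_locales auto
  define \<psi> where "\<psi> k = orth_bspline M (\<lambda>\<omega>. X \<omega> $ k) (a $ k) (b $ k) (p k) (n k) (\<xi> k)" for k
  define I where "I k = {1..n k}" for k
  let ?\<Psi> = "multi_orth_bspline M X a b p n \<xi>"
  have \<Psi>: "?\<Psi> = (\<lambda>i x. \<Prod>k\<in>UNIV. \<psi> k (i k) (x $ k))"
    by (simp add: fun_eq_iff multi_orth_bspline_def \<psi>_def)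
  have J: "multi_indices n = {i. \<forall>k. i k \<in> I k}" by (simp add: multi_indices_def I_def)
  have J_PiE: "multi_indices n = PiE UNIV I" unfolding J by (auto simp: PiE_UNIV_domain)
  have fin: "finite (multi_indices n)" unfolding J_PiE by (intro finite_PiE) (auto simp: I_def)
  note basis = spline_random_variable.borel_measurable_orth_bspline[OF coordinate, folded \<psi>_def I_def]
    spline_random_variable.integrable_orth_bspline[OF coordinate, folded \<psi>_def I_def]
    spline_random_variable.orth_bspline_orthonormal[OF coordinate, folded \<psi>_def I_def]
  have "integrable M (\<lambda>\<omega>. ?\<Psi> i (X \<omega>) * ?\<Psi> j (X \<omega>))"
    "expectation (\<lambda>\<omega>. ?\<Psi> i (X \<omega>) * ?\<Psi> j (X \<omega>)) = (if i = j then 1 else 0)"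
    if "i \<in> multi_indices n" "j \<in> multi_indices n" for i j
    unfolding \<Psi> using that unfolding J
    by (intro orthonormal_products[OF assms(4), where I = I and t = \<psi>]; use basis in simp)+
  note independent = orthonormal_independent[of "multi_indices n" ?\<Psi> X, OF fin this]
  have span: "tensor_product (\<lambda>k. fun_space.span (\<psi> k ` I k)) = fun_space.span (?\<Psi> ` multi_indices n)"
    unfolding \<Psi> J by (rule tensor_product_span) (simp add: I_def)
  moreover have "fun_space.span (\<psi> k ` I k) = spline_space (a $ k) (b $ k) (p k) (n k) (\<xi> k)" for k
    unfolding \<psi>_def I_def by (rule spline_random_variable.span_orth_bspline[OF coordinate])
  ultimately have "tensor_product (\<lambda>k. spline_space (a $ k) (b $ k) (p k) (n k) (\<xi> k)) =
      fun_space.span (?\<Psi> ` multi_indices n)" by simp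
  moreover have "card (multi_indices n) = (\<Prod>k\<in>UNIV. n k)"
    unfolding J_PiE by (simp add: card_PiE I_def)
  ultimately show ?thesis using independent span unfolding \<psi>_def I_def by simp
qed

end
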